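(* Let $n\ge 1$ and let an almost symmetric numerical semigroup $S=S(\mathbf d^{2n+1})$, minimally generated by $\mathbf d^{2n+1}=\{d_1,\dots,d_{2n+1}\}$, be given, with Betti numbers $\beta_i=\beta_i(\mathbf d^{2n+1})$, $\gamma=\#\Delta_{\mathcal H}$, and $\delta=\wp-\ell$ (all defined in the context). Then $$\beta_1+\beta_3+\dots+\beta_{2n-1}=\gamma\cdot 2^{2n-1}+\tfrac12\,\delta+1,$$ $$\beta_2+\beta_4+\dots+\beta_{2n-2}=\gamma\cdot\left(2^{2n-1}-1\right)+\tfrac12\,\delta-1$$ (for $n=1$ the left-hand side of the second equality is the empty sum).
   Context: Semigroup. Let $m=2n+1$ and let $d_1<\dots<d_m$ be positive integers with $\gcd(d_1,\dots,d_m)=1$, none a nonnegative integer linear combination of the others, $S=\{\sum_{i=1}^m x_id_i : x_i\in\mathbb Z_{\ge 0}\}$, $F$ the largest integer not in $S$, $\Sigma_m=\sum_{k=1}^m d_k$. Put $S'=\{x\in\mathbb Z : x\notin S,\ x+s\in S \text{ for all } s\in S\setminus\{0\}\}$ and $\Delta_{\mathcal H}=\{h\notin S : F-h\notin S\}$, $\gamma=\#\Delta_{\mathcal H}$. $S$ is almost symmetric if $S'\setminus\{F\}=\Delta_{\mathcal H}$. Syzygies. Let $k$ be a field of characteristic $0$, and regard $k[z^{d_1},\dots,z^{d_m}]$ as a graded module over $k[X_1,\dots,X_m]$, $\deg X_i=d_i$, via $X_i\mapsto z^{d_i}$. Its Hilbert series is written $\sum_{s\in S}z^s=Q(z)/\prod_{j=1}^m(1-z^{d_j})$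 with $Q=1-Q_1+Q_2-\dots+(-1)^{m-1}Q_{m-1}$ and $Q_i(z)=\sum_{j=1}^{\beta_i}z^{C_{j,i}}$ for $1\le i\le m-1$. The summands $z^{C_{j,i}}$ stand for the syzygies of the $i$th kind (those of the $i$th step of the minimal graded free resolution); the positive integers $C_{j,i}$ are the syzygy degrees and the numbers $\beta_i$ of terms the Betti numbers. They are subject to the standing requirements $C_{j+1,i}\ge C_{j,i}$, $C_{\beta_{i+1},i+1}>C_{\beta_i,i}$, $C_{1,i+1}>C_{1,i}$, and $$C_{j,i}\ne C_{r,i+2k-1}\quad\text{for } 1\le j\le\beta_i,\ 1\le r\le\beta_{i+2k-1},\ 1\le k\le\lfloor (m-i)/2\rfloor ;$$ the last requirement means that all necessary cancellations of terms $z^{C_{j,i}}$ in the alternating sum $Q$ are already performed. Put $\overline C_{j,i}=F+\Sigma_m-C_{j,i}$. Multiset operations. For finite multisets of integers with multiplicity functions $\sigma_1,\sigma_2$: $\bigvee$ (join) has multiplicity $\sigma_1+\sigma_2$; $\bigwedge$ (intersection) has multiplicity $\min\{\sigma_1,\sigma_2\}$; $\#$ denotes cardinality counted with multiplicity. Multisets. For $1\le i\le m-1$ let $\mathfrak L_i$ be the multiset of all integers $\sum_{j\in I}d_j+h$, where $I$ runs over the $i$-element subsets of $\{1,\dots,m\}$ and $h$ over $\Delta_{\mathcal H}$, counted with multiplicity. $\mathfrak L_o$ (resp. $\mathfrak L_e$) is the join of all $\mathfrak L_i$ with $i$ odd (resp. even), $1\le i\le m-1$. Let $\mathfrak B_i=\{C_{j,i}:1\le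 j\le\beta_i\}$ and $\overline{\mathfrak B}_i=\{\overline C_{j,i}:1\le j\le\beta_i\}$ as multisets, $\mathfrak B_o=\bigvee_{i=1}^{n}\mathfrak B_{2i-1}$, $\mathfrak B_e=\bigvee_{i=1}^{n-1}\mathfrak B_{2i}$, $\overline{\mathfrak B}_o=\bigvee_{i=1}^{n}\overline{\mathfrak B}_{2i-1}$, $\overline{\mathfrak B}_e=\bigvee_{i=1}^{n-1}\overline{\mathfrak B}_{2i}$ (empty joins are the empty multiset). Put $\ell=\#\left(\mathfrak L_e\bigwedge\mathfrak L_o\right)$, $\wp=\#\left(\left[\mathfrak B_o\bigvee\overline{\mathfrak B}_e\right]\bigwedge\left[\mathfrak B_e\bigvee\overline{\mathfrak B}_o\right]\right)$, $\delta=\wp-\ell$. *)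

theory Defs
  imports
    "HOL-Library.Poly_Mapping"
    "HOL-Computational_Algebra.Computational_Algebra"
begin

section \<open>Numerical semigroups\<close>

definition minimal_generators :: "nat \<Rightarrow> (nat \<Rightarrow> nat) \<Rightarrow> bool" where
  "minimal_generators m d \<longleftrightarrow>
     (\<forall>i\<in>{1..m}. 0 < d i) \<and>
     strict_mono_on {1..m} d \<and>
     Gcd (d ` {1..m}) = 1 \<and>
     (\<forall>i\<in>{1..m}. \<not> (\<exists>x :: nat \<Rightarrow> nat. d i = (\<Sum>j\<in>{1..m} - {i}. x j * d j)))"

definition semigroup_of :: "nat \<Rightarrow> (nat \<Rightarrow> nat) \<Rightarrow> int set" where
  "semigroup_of m d = {int (\<Sum>i=1..m. x i * d i) | x :: nat \<Rightarrow> nat. True}"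

definition frobenius :: "int set \<Rightarrow> int" where
  "frobenius S = (GREATEST x. x \<notin> S)"

definition pseudo_frobenius :: "int set \<Rightarrow> int set" where
  "pseudo_frobenius S = {x. x \<notin> S \<and> (\<forall>s\<in>S - {0}. x + s \<in> S)}"

text \<open>All integers are admitted, but for a numerical semigroup only gaps of \<open>S\<close> qualify:
  if \<open>h < 0\<close> or \<open>h > F\<close>, then one of \<open>h\<close>, \<open>F - h\<close> exceeds \<open>F\<close>. So the set is finite.\<close>

definition Delta_H :: "int set \<Rightarrow> int set" where
  "Delta_H S = {h. h \<notin> S \<and> frobenius S - h \<notin> S}"

definition almost_symmetric :: "int set \<Rightarrow> bool" where
  "almost_symmetric S \<longleftrightarrow> pseudo_frobenius S - {frobenius S} = Delta_H S"

definition Sigma_gen :: "nat \<Rightarrow> (nat \<Rightarrow> nat) \<Rightarrow> int" where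
  "Sigma_gen m d = int (\<Sum>k=1..m. d k)"


section \<open>Minimal graded free resolutions over weighted polynomial rings\<close>

text \<open>The elements of \<^typ>\<open>(nat \<Rightarrow>\<^sub>0 nat) \<Rightarrow>\<^sub>0 'k\<close> are finitely supported families of coefficients
  indexed by exponent vectors, i.e. polynomials in the variables \<open>X\<^sub>i\<close> (\<open>i :: nat\<close>) over \<open>'k\<close>;
  multiplication is convolution. The polynomial ring in \<open>X\<^sub>1, \<dots>, X\<^sub>m\<close> is the subring
  \<open>poly_ring m\<close>.\<close>

type_synonym 'k mpol = "(nat \<Rightarrow>\<^sub>0 nat) \<Rightarrow>\<^sub>0 'k"

definition poly_ring :: "nat \<Rightarrow> 'k::comm_ring_1 mpol set" where
  "poly_ring m = {p. \<forall>\<mu>\<in>Poly_Mapping.keys p. Poly_Mapping.keys \<mu> \<subseteq> {1..m}}"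

definition weight :: "(nat \<Rightarrow> nat) \<Rightarrow> (nat \<Rightarrow>\<^sub>0 nat) \<Rightarrow> nat" where
  "weight d \<mu> = (\<Sum>i\<in>Poly_Mapping.keys \<mu>. Poly_Mapping.lookup \<mu> i * d i)"

text \<open>The \<open>'k\<close>-algebra homomorphism \<open>X\<^sub>i \<mapsto> z ^ d i\<close>.\<close>

definition monomial_curve_map :: "(nat \<Rightarrow> nat) \<Rightarrow> 'k::comm_ring_1 mpol \<Rightarrow> 'k poly" where
  "monomial_curve_map d p =
     (\<Sum>\<mu>\<in>Poly_Mapping.keys p.
        [:Poly_Mapping.lookup p \<mu>:] *
        (\<Prod>i\<in>Poly_Mapping.keys \<mu>. monom 1 (d i) ^ Poly_Mapping.lookup \<mu> i))"

text \<open>The free module of rank \<open>b\<close> over \<open>poly_ring m\<close>, with coordinates indexed by \<open>{1..b}\<close>.\<close>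

definition free_module :: "nat \<Rightarrow> nat \<Rightarrow> (nat \<Rightarrow> 'k::comm_ring_1 mpol) set" where
  "free_module m b = {v. \<forall>j. if j \<in> {1..b} then v j \<in> poly_ring m else v j = 0}"

definition matrix_map ::
  "nat \<Rightarrow> nat \<Rightarrow> (nat \<Rightarrow> nat \<Rightarrow> 'k::comm_ring_1 mpol) \<Rightarrow> (nat \<Rightarrow> 'k mpol) \<Rightarrow> nat \<Rightarrow> 'k mpol" where
  "matrix_map a b A v = (\<lambda>r. if r \<in> {1..a} then \<Sum>j=1..b. A r j * v j else 0)"

text \<open>
  \<open>0 \<rightarrow> F\<^bsub>m-1\<^esub> \<rightarrow> \<dots> \<rightarrow> F\<^sub>1 \<rightarrow> F\<^sub>0 \<rightarrow> k[z ^ d 1, \<dots>, z ^ d m] \<rightarrow> 0\<close>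
  is a minimal graded free resolution, where \<open>F\<^sub>i\<close> has a homogeneous basis of \<open>\<beta> i\<close> elements of
  degrees \<open>C 1 i, \<dots>, C (\<beta> i) i\<close> and \<open>F\<^sub>0\<close> is the polynomial ring itself. The \<open>i\<close>-th
  differential is given by the matrix \<open>M i\<close>, with \<open>\<beta> (i - 1)\<close> rows and \<open>\<beta> i\<close> columns; it is
  homogeneous of degree \<open>0\<close>, and minimality says that its entries lie in the ideal generated by
  \<open>X\<^sub>1, \<dots>, X\<^sub>m\<close>, i.e. have vanishing constant term. The last three conjuncts are exactness at
  \<open>F\<^sub>0\<close>, at \<open>F\<^sub>i\<close> for \<open>1 \<le> i < m - 1\<close>, and at \<open>F\<^bsub>m-1\<^esub>\<close>; surjectivity of the augmentation
  holds by definition of its target.\<close>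

definition minimal_graded_resolution ::
  "nat \<Rightarrow> (nat \<Rightarrow> nat) \<Rightarrow> (nat \<Rightarrow> nat) \<Rightarrow> (nat \<Rightarrow> nat \<Rightarrow> nat) \<Rightarrow>
   (nat \<Rightarrow> nat \<Rightarrow> nat \<Rightarrow> 'k::field_char_0 mpol) \<Rightarrow> bool" where
  "minimal_graded_resolution m d \<beta> C M \<longleftrightarrow>
     \<beta> 0 = 1 \<and> C 1 0 = 0 \<and>
     (\<forall>i\<in>{1..m - 1}. \<forall>r\<in>{1..\<beta> (i - 1)}. \<forall>j\<in>{1..\<beta> i}.
        M i r j \<in> poly_ring m \<and>
        (\<forall>\<mu>\<in>Poly_Mapping.keys (M i r j). weight d \<mu> + C r (i - 1) = C j i) \<and>
        Poly_Mapping.lookup (M i r j) 0 = 0) \<and>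
     {v \<in> free_module m (\<beta> 0). monomial_curve_map d (v 1) = 0} =
        matrix_map (\<beta> 0) (\<beta> 1) (M 1) ` free_module m (\<beta> 1) \<and>
     (\<forall>i. 1 \<le> i \<and> i < m - 1 \<longrightarrow>
        {v \<in> free_module m (\<beta> i). matrix_map (\<beta> (i - 1)) (\<beta> i) (M i) v = (\<lambda>_. 0)} =
          matrix_map (\<beta> i) (\<beta> (i + 1)) (M (i + 1)) ` free_module m (\<beta> (i + 1))) \<and>
     {v \<in> free_module m (\<beta> (m - 1)).
        matrix_map (\<beta> (m - 2)) (\<beta> (m - 1)) (M (m - 1)) v = (\<lambda>_. 0)} = {\<lambda>_. 0}"


section \<open>Hilbert series and syzygy degrees\<close>

definition hilbert_series :: "int set \<Rightarrow> rat fps" where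
  "hilbert_series S = Abs_fps (\<lambda>s. if int s \<in> S then 1 else 0)"

definition Q_part :: "(nat \<Rightarrow> nat) \<Rightarrow> (nat \<Rightarrow> nat \<Rightarrow> nat) \<Rightarrow> nat \<Rightarrow> rat fps" where
  "Q_part \<beta> C i = (\<Sum>j=1..\<beta> i. fps_X ^ C j i)"

definition hilbert_numerator ::
  "nat \<Rightarrow> (nat \<Rightarrow> nat) \<Rightarrow> (nat \<Rightarrow> nat \<Rightarrow> nat) \<Rightarrow> rat fps" where
  "hilbert_numerator m \<beta> C = 1 + (\<Sum>i=1..m - 1. (- 1) ^ i * Q_part \<beta> C i)"

definition standing_requirements ::
  "nat \<Rightarrow> (nat \<Rightarrow> nat) \<Rightarrow> (nat \<Rightarrow> nat \<Rightarrow> nat) \<Rightarrow> bool" where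
  "standing_requirements m \<beta> C \<longleftrightarrow>
     (\<forall>i\<in>{1..m - 1}. \<forall>j\<in>{1..\<beta> i}. 0 < C j i) \<and>
     (\<forall>i\<in>{1..m - 1}. \<forall>j. 1 \<le> j \<and> j < \<beta> i \<longrightarrow> C j i \<le> C (j + 1) i) \<and>
     (\<forall>i. 1 \<le> i \<and> i < m - 1 \<longrightarrow>
        C (\<beta> i) i < C (\<beta> (i + 1)) (i + 1) \<and> C 1 i < C 1 (i + 1)) \<and>
     (\<forall>i\<in>{1..m - 1}. \<forall>k\<in>{1..(m - i) div 2}.
        \<forall>j\<in>{1..\<beta> i}. \<forall>r\<in>{1..\<beta> (i + 2 * k - 1)}. C j i \<noteq> C r (i + 2 * k - 1))"

definition syzygy_data ::
  "nat \<Rightarrow> (nat \<Rightarrow> nat) \<Rightarrow> (nat \<Rightarrow> nat) \<Rightarrow> (nat \<Rightarrow> nat \<Rightarrow> nat) \<Rightarrow>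
   (nat \<Rightarrow> nat \<Rightarrow> nat \<Rightarrow> 'k::field_char_0 mpol) \<Rightarrow> bool" where
  "syzygy_data m d \<beta> C M \<longleftrightarrow>
     minimal_graded_resolution m d \<beta> C M \<and>
     hilbert_series (semigroup_of m d) =
       hilbert_numerator m \<beta> C / (\<Prod>j=1..m. 1 - fps_X ^ d j) \<and>
     standing_requirements m \<beta> C"


section \<open>The multisets\<close>

text \<open>The join of finite multisets is \<open>+\<close> (and \<open>\<Sum>\<close> for families), the intersection is \<open>\<inter>#\<close>.\<close>

definition L_mset :: "nat \<Rightarrow> (nat \<Rightarrow> nat) \<Rightarrow> nat \<Rightarrow> int multiset" where
  "L_mset m d i =
     (\<Sum>I\<in>{I. I \<subseteq> {1..m} \<and> card I = i}.
        image_mset (\<lambda>h. int (\<Sum>j\<in>I. d j) + h) (mset_set (Delta_H (semigroup_of m d))))"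

definition L_odd :: "nat \<Rightarrow> (nat \<Rightarrow> nat) \<Rightarrow> int multiset" where
  "L_odd m d = (\<Sum>i\<in>{i\<in>{1..m - 1}. odd i}. L_mset m d i)"

definition L_even :: "nat \<Rightarrow> (nat \<Rightarrow> nat) \<Rightarrow> int multiset" where
  "L_even m d = (\<Sum>i\<in>{i\<in>{1..m - 1}. even i}. L_mset m d i)"

definition B_mset :: "(nat \<Rightarrow> nat) \<Rightarrow> (nat \<Rightarrow> nat \<Rightarrow> nat) \<Rightarrow> nat \<Rightarrow> int multiset" where
  "B_mset \<beta> C i = image_mset (\<lambda>j. int (C j i)) (mset_set {1..\<beta> i})"

definition Bbar_mset ::
  "nat \<Rightarrow> (nat \<Rightarrow> nat) \<Rightarrow> (nat \<Rightarrow> nat) \<Rightarrow> (nat \<Rightarrow> nat \<Rightarrow> nat) \<Rightarrow> nat \<Rightarrow> int multiset" where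
  "Bbar_mset m d \<beta> C i =
     image_mset (\<lambda>j. frobenius (semigroup_of m d) + Sigma_gen m d - int (C j i))
       (mset_set {1..\<beta> i})"

definition ell :: "nat \<Rightarrow> (nat \<Rightarrow> nat) \<Rightarrow> nat" where
  "ell n d = size (L_even (2 * n + 1) d \<inter># L_odd (2 * n + 1) d)"

text \<open>The even joins stop at index \<open>2n - 2\<close>: the last step \<open>2n = m - 1\<close> of the resolution is
  not included.\<close>

definition wp :: "nat \<Rightarrow> (nat \<Rightarrow> nat) \<Rightarrow> (nat \<Rightarrow> nat) \<Rightarrow> (nat \<Rightarrow> nat \<Rightarrow> nat) \<Rightarrow> nat" where
  "wp n d \<beta> C =
     (let Bo = (\<Sum>i=1..n. B_mset \<beta> C (2 * i - 1));
          Be = (\<Sum>i=1..n - 1. B_mset \<beta> C (2 * i));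
          Bbo = (\<Sum>i=1..n. Bbar_mset (2 * n + 1) d \<beta> C (2 * i - 1));
          Bbe = (\<Sum>i=1..n - 1. Bbar_mset (2 * n + 1) d \<beta> C (2 * i))
      in size ((Bo + Bbe) \<inter># (Be + Bbo)))"

definition delta :: "nat \<Rightarrow> (nat \<Rightarrow> nat) \<Rightarrow> (nat \<Rightarrow> nat) \<Rightarrow> (nat \<Rightarrow> nat \<Rightarrow> nat) \<Rightarrow> int" where
  "delta n d \<beta> C = int (wp n d \<beta> C) - int (ell n d)"

end

theory Submission
  imports Defs "HOL-Library.Function_Algebras"
begin

text \<open>
  Write \<open>Q\<close> for the numerator of the Hilbert series, \<open>F\<close> for the Frobenius number, \<open>\<Sigma>\<close> for the sum of the
  generators and \<open>\<Delta>(z)\<close> for the generating function of \<open>\<Delta>\<^sub>H\<close>. The integers are the disjoint union of \<open>S\<close>,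
  \<open>F - S\<close> and \<open>\<Delta>\<^sub>H\<close>, so for odd \<open>m\<close> multiplication by \<open>\<Prod>\<^sub>j (1 - z ^ d j)\<close> gives
  \<open>Q(z) - z ^ (F + \<Sigma>) Q(1/z) = - \<Delta>(z) \<Prod>\<^sub>j (1 - z ^ d j)\<close>.
  The degrees of the last syzygies are \<open>f + \<Sigma>\<close> with \<open>f\<close> pseudo-Frobenius, each occurring once; for almost
  symmetric \<open>S\<close> these \<open>f\<close> are \<open>F\<close> and the elements of \<open>\<Delta>\<^sub>H\<close>. Cancelling their contribution turns the
  functional equation into an identity of multisets,
  \<open>B\<^sub>e + B'\<^sub>o + L\<^sub>e = B\<^sub>o + B'\<^sub>e + L\<^sub>o\<close> (primes denoting reflection). Removing the common parts of the two pairs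
  and taking sizes gives the sum of the two Betti sums; \<open>Q(1) = 0\<close> gives their difference.

  The last syzygies are found by comparing the resolution \<open>R\<^sub>\<bullet>\<close> with the Koszul complex \<open>K\<^sub>\<bullet>\<close> of the variables:
  a zigzag in the double complex \<open>K\<^sub>p \<otimes> R\<^sub>q\<close> along \<open>p + q = m - 1\<close> identifies \<open>R\<^bsub>m-1\<^esub>\<close> modulo the variables with
  the Koszul homology of \<open>k[S]\<close> in position \<open>m - 1\<close>. In degree \<open>a\<close> the latter is nonzero, and
  then of dimension one, exactly if \<open>a - \<Sigma>\<close> is not in \<open>S\<close> but all \<open>a - \<Sigma> + d i\<close> are.
\<close>

section \<open>Coefficients, weights and the subring \<open>poly_ring\<close>\<close>

section \<open>Polynomials as poly mappings\<close>

lemma lookup_single_mult_add: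
  fixes p :: "'a::cancel_comm_monoid_add \<Rightarrow>\<^sub>0 'b::semiring_1"
  shows "Poly_Mapping.lookup (Poly_Mapping.single \<kappa> c * p) (\<kappa> + \<mu>) = c * Poly_Mapping.lookup p \<mu>"
  by (simp add: lookup_mult lookup_single when_mult)

lemma lookup_single_mult_notin:
  fixes p :: "'a::cancel_comm_monoid_add \<Rightarrow>\<^sub>0 'b::semiring_1"
  assumes "\<And>\<mu>. \<nu> \<noteq> \<kappa> + \<mu>"
  shows "Poly_Mapping.lookup (Poly_Mapping.single \<kappa> c * p) \<nu> = 0"
  using assms by (simp add: lookup_mult lookup_single when_mult)

lemma keys_mult_single:
  fixes p :: "'a::cancel_comm_monoid_add \<Rightarrow>\<^sub>0 'b::semiring_1"
  shows "Poly_Mapping.keys (Poly_Mapping.single \<kappa> 1 * p) = (+) \<kappa> ` Poly_Mapping.keys p"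
proof (intro equalityI subsetI)
  fix \<nu> assume n: "\<nu> \<in> Poly_Mapping.keys (Poly_Mapping.single \<kappa> 1 * p)"
  then obtain \<mu> where "\<nu> = \<kappa> + \<mu>"
    using lookup_single_mult_notin[of \<nu> \<kappa> 1 p] by (auto simp: in_keys_iff)
  with n show "\<nu> \<in> (+) \<kappa> ` Poly_Mapping.keys p"
    by (auto simp: in_keys_iff lookup_single_mult_add)
qed (auto simp: in_keys_iff lookup_single_mult_add)

lemma weight_eq_sum:
  assumes "finite A" "Poly_Mapping.keys \<mu> \<subseteq> A"
  shows "weight d \<mu> = (\<Sum>i\<in>A. Poly_Mapping.lookup \<mu> i * d i)"
  unfolding weight_def by (rule sum.mono_neutral_left) (use assms in \<open>auto simp: in_keys_iff\<close>)

lemma weight_add: "weight d (\<mu> + \<nu>) = weight d \<mu> + weight d \<nu>"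
proof -
  let ?A = "Poly_Mapping.keys \<mu> \<union> Poly_Mapping.keys \<nu>"
  have "Poly_Mapping.keys (\<mu> + \<nu>) \<subseteq> ?A" by (rule keys_add)
  then show ?thesis
    by (simp add: weight_eq_sum[of ?A] lookup_add algebra_simps sum.distrib)
qed

lemma weight_0: "weight d 0 = 0" by (simp add: weight_def)

lemma weight_single: "weight d (Poly_Mapping.single i k) = k * d i"
  by (simp add: weight_def)

lemma poly_ring_0 [simp]: "0 \<in> poly_ring m"
  by (simp add: poly_ring_def)

lemma poly_ring_1 [simp]: "1 \<in> poly_ring m"
  by (simp add: poly_ring_def)

lemma poly_ring_add: "p \<in> poly_ring m \<Longrightarrow> q \<in> poly_ring m \<Longrightarrow> p + q \<in> poly_ring m"
  using keys_add[of p q] unfolding poly_ring_def by blast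

lemma poly_ring_uminus:
  "p \<in> poly_ring m \<Longrightarrow> - p \<in> poly_ring m"
  unfolding poly_ring_def by (simp add: in_keys_iff)

lemma poly_ring_diff:
  "p \<in> poly_ring m \<Longrightarrow> q \<in> poly_ring m \<Longrightarrow> p - q \<in> poly_ring m"
  using poly_ring_add[OF _ poly_ring_uminus] by fastforce

lemma poly_ring_mult: "p \<in> poly_ring m \<Longrightarrow> q \<in> poly_ring m \<Longrightarrow> p * q \<in> poly_ring m"
proof -
  assume a: "p \<in> poly_ring m" "q \<in> poly_ring m"
  { fix \<mu> assume "\<mu> \<in> Poly_Mapping.keys (p * q)"
    then obtain x y where "x \<in> Poly_Mapping.keys p" "y \<in> Poly_Mapping.keys q" "\<mu> = x + y"
      using keys_mult[of p q] by blast
    then have "Poly_Mapping.keys \<mu> \<subseteq> {1..m}"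
      using a keys_add[of x y] unfolding poly_ring_def by blast }
  then show ?thesis by (simp add: poly_ring_def)
qed

lemma poly_ring_sum: "(\<And>i. i \<in> A \<Longrightarrow> f i \<in> poly_ring m) \<Longrightarrow> sum f A \<in> poly_ring m"
  by (induction A rule: infinite_finite_induct) (auto simp: poly_ring_add)

definition pvar :: "nat \<Rightarrow> 'k::comm_ring_1 mpol" where
  "pvar i = Poly_Mapping.single (Poly_Mapping.single i 1) 1"

lemma poly_ring_pvar: "i \<in> {1..m} \<Longrightarrow> pvar i \<in> poly_ring m"
  by (auto simp: poly_ring_def pvar_def)

lemma lookup_pvar_mult_add:
  "Poly_Mapping.lookup (pvar i * p) (Poly_Mapping.single i 1 + \<mu>) = Poly_Mapping.lookup p \<mu>"
  by (simp only: pvar_def lookup_single_mult_add mult_1)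

lemma lookup_pvar_mult_notin:
  "i \<notin> Poly_Mapping.keys \<mu> \<Longrightarrow> Poly_Mapping.lookup (pvar i * p) \<mu> = 0"
  unfolding pvar_def by (rule lookup_single_mult_notin) (auto simp: in_keys_iff lookup_add)

section \<open>The Koszul complex\<close>

text \<open>The sign of moving the basis vector \<open>i\<close> to its sorted place in the wedge
  indexed by \<open>insert i I\<close>.\<close>

definition kos_sign :: "nat \<Rightarrow> nat set \<Rightarrow> 'k::comm_ring_1" where
  "kos_sign i I = (- 1) ^ card {k \<in> I. k < i}"

text \<open>The Koszul differential in coordinates: \<open>u I\<close> is the coefficient of the
  wedge of the basis vectors in \<open>I\<close>, so the value at \<open>I\<close> gathers the terms
  of all sets with one more vertex. One map serves all homological degrees.\<close>

definition koszul :: "nat \<Rightarrow> (nat set \<Rightarrow> 'k::comm_ring_1 mpol) \<Rightarrow> nat set \<Rightarrow> 'k mpol" where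
  "koszul m u I =
     (if I \<subseteq> {1..m} then \<Sum>i\<in>{1..m} - I. kos_sign i I * (pvar i * u (insert i I)) else 0)"

lemma kos_sign_cases: "(kos_sign i I :: 'a::comm_ring_1) = 1 \<or> kos_sign i I = - 1"
  unfolding kos_sign_def by (cases "even (card {k \<in> I. k < i})") auto

lemma kos_sign_sq: "kos_sign i I * kos_sign i I = (1 :: 'a::comm_ring_1)"
  by (simp add: kos_sign_def flip: power_mult_distrib)

lemma lookup_kos_sign_mult:
  fixes p :: "'k::comm_ring_1 mpol"
  shows "Poly_Mapping.lookup (kos_sign i I * p) \<mu> = kos_sign i I * Poly_Mapping.lookup p \<mu>"
  unfolding kos_sign_def
  by (cases "even (card {k \<in> I. k < i})") auto

lemma kos_sign_insert_ge: "j \<ge> i \<Longrightarrow> kos_sign i (insert j I) = kos_sign i I"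
  unfolding kos_sign_def by (rule arg_cong[where f = "\<lambda>A. (- 1) ^ card A"]) auto

lemma kos_sign_insert_less:
  "finite I \<Longrightarrow> j < i \<Longrightarrow> j \<notin> I \<Longrightarrow> kos_sign i (insert j I) = - kos_sign i I"
proof -
  assume a: "finite I" "j < i" "j \<notin> I"
  then have "{k \<in> insert j I. k < i} = insert j {k \<in> I. k < i}" by auto
  with a show ?thesis by (simp add: kos_sign_def)
qed

lemma koszul_0 [simp]: "koszul m (\<lambda>I. 0) I = 0"
  by (simp add: koszul_def)

lemma koszul_add: "koszul m (\<lambda>I. u I + v I) I = koszul m u I + koszul m v I"
  by (simp add: koszul_def algebra_simps sum.distrib)

lemma koszul_diff: "koszul m (\<lambda>I. u I - v I) I = koszul m u I - koszul m v I"
  by (simp add: koszul_def algebra_simps sum_subtractf)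

lemma koszul_mult: "koszul m (\<lambda>I. c * u I) I = c * koszul m u I"
  by (simp add: koszul_def sum_distrib_left algebra_simps)

lemma koszul_sum: "koszul m (\<lambda>I. \<Sum>j\<in>A. u j I) I = (\<Sum>j\<in>A. koszul m (u j) I)"
  by (induction A rule: infinite_finite_induct) (simp_all add: koszul_add)

text \<open>Two distinct vertices are adjoined to \<open>I\<close> in two orders, and the two terms
  have opposite signs.\<close>

lemma koszul_koszul: "koszul m (koszul m u) I = (0 :: 'k::comm_ring_1 mpol)"
proof (cases "I \<subseteq> {1..m}")
  case True
  then have fin: "finite I" by (rule finite_subset) simp
  let ?A = "{1..m} - I"
  let ?f = "\<lambda>i j. kos_sign i I * (pvar i * (kos_sign j (insert i I) * (pvar j * u (insert j (insert i I)))))"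
  \<comment> \<open>Adjoining the smaller index flips the sign of the larger one; adjoining the
    larger index leaves the sign of the smaller one alone.\<close>
  have anti: "?f i j = - ?f j i" if "i < j" "i \<in> ?A" "j \<in> ?A" for i j
    using that fin
    by (simp add: kos_sign_insert_ge kos_sign_insert_less insert_commute algebra_simps)
  have "koszul m (koszul m u) I = (\<Sum>i\<in>?A. \<Sum>j\<in>?A - {i}. ?f i j)"
    using True
    by (auto simp: koszul_def sum_distrib_left Diff_insert2[symmetric] intro!: sum.cong)
  also have "\<dots> = (\<Sum>i\<in>?A. (\<Sum>j\<in>{j\<in>?A. j < i}. ?f i j) + (\<Sum>j\<in>{j\<in>?A. i < j}. ?f i j))"
    by (intro sum.cong refl, subst sum.union_disjoint[symmetric]) (auto intro!: sum.cong)
  also have "\<dots> = (\<Sum>i\<in>?A. \<Sum>j\<in>{j\<in>?A. j < i}. ?f i j) + (\<Sum>i\<in>?A. \<Sum>j\<in>{j\<in>?A. i < j}. ?f i j)"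
    by (rule sum.distrib)
  also have "(\<Sum>i\<in>?A. \<Sum>j\<in>{j\<in>?A. i < j}. ?f i j) = (\<Sum>j\<in>?A. \<Sum>i\<in>{i\<in>?A. i < j}. ?f i j)"
    by (rule sum.swap_restrict) auto
  also have "\<dots> = (\<Sum>j\<in>?A. \<Sum>i\<in>{i\<in>?A. i < j}. - ?f j i)"
    by (intro sum.cong refl) (rule anti, auto)
  finally show ?thesis by (simp add: sum_negf)
qed (simp add: koszul_def)

text \<open>The contracting homotopy. The Koszul complex is graded by the multidegree
  \<open>\<mu> + 1\<^sub>I\<close>; in each nonzero multidegree it is the chain complex of a full simplex, contracted here
  to the least vertex.\<close>

definition cone :: "(nat set \<Rightarrow> 'k::comm_ring_1 mpol) \<Rightarrow> nat set \<Rightarrow> 'k mpol" where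
  "cone u I = Abs_poly_mapping (\<lambda>\<mu>. let i = Min (Poly_Mapping.keys \<mu> \<union> I) in
     if i \<in> I then Poly_Mapping.lookup (u (I - {i})) (\<mu> + Poly_Mapping.single i 1) else 0)"

text \<open>The function inside \<open>Abs_poly_mapping\<close> has finite support: each exponent in
  it comes from an exponent of some \<open>u (I - {i})\<close> by lowering one variable, and
  \<open>I\<close> is finite.\<close>

lemma lookup_cone:
  assumes "finite I"
  shows "Poly_Mapping.lookup (cone u I) \<mu> = (let i = Min (Poly_Mapping.keys \<mu> \<union> I) in
     if i \<in> I then Poly_Mapping.lookup (u (I - {i})) (\<mu> + Poly_Mapping.single i 1) else 0)"
proof -
  let ?f = "\<lambda>\<mu>. let i = Min (Poly_Mapping.keys \<mu> \<union> I) in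
     if i \<in> I then Poly_Mapping.lookup (u (I - {i})) (\<mu> + Poly_Mapping.single i 1) else 0"
  have "{\<mu>. ?f \<mu> \<noteq> 0} \<subseteq>
      (\<Union>i\<in>I. (\<lambda>\<nu>. \<nu> - Poly_Mapping.single i 1) ` Poly_Mapping.keys (u (I - {i})))"
  proof
    fix \<mu> assume "\<mu> \<in> {\<mu>. ?f \<mu> \<noteq> 0}"
    then obtain i where "i \<in> I" "Poly_Mapping.lookup (u (I - {i})) (\<mu> + Poly_Mapping.single i 1) \<noteq> 0"
      by (auto simp: Let_def split: if_splits)
    then show "\<mu> \<in> (\<Union>i\<in>I. (\<lambda>\<nu>. \<nu> - Poly_Mapping.single i 1) ` Poly_Mapping.keys (u (I - {i})))"
      by (auto simp: in_keys_iff intro!: bexI[of _ i] image_eqI[of _ _ "\<mu> + Poly_Mapping.single i 1"])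
  qed
  then have "finite {\<mu>. ?f \<mu> \<noteq> 0}"
    by (rule finite_subset) (use assms in auto)
  then show ?thesis unfolding cone_def by simp
qed

lemma keys_coneD:
  assumes "finite I" "\<mu> \<in> Poly_Mapping.keys (cone u I)"
  shows "\<exists>i\<in>I. \<mu> + Poly_Mapping.single i 1 \<in> Poly_Mapping.keys (u (I - {i}))"
  using assms(2) unfolding in_keys_iff lookup_cone[OF assms(1)]
  by (auto simp: Let_def split: if_splits)

lemma cone_poly_ring:
  assumes "I \<subseteq> {1..m}" "\<And>J. u J \<in> poly_ring m"
  shows "cone u I \<in> poly_ring m"
  unfolding poly_ring_def
proof safe
  fix \<mu> i assume m: "\<mu> \<in> Poly_Mapping.keys (cone u I)" and i: "i \<in> Poly_Mapping.keys \<mu>"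
  have "finite I" using assms(1) by (rule finite_subset) simp
  from keys_coneD[OF this m] obtain k where
    "\<mu> + Poly_Mapping.single k 1 \<in> Poly_Mapping.keys (u (I - {k}))" by blast
  with assms(2) have "Poly_Mapping.keys (\<mu> + Poly_Mapping.single k 1) \<subseteq> {1..m}"
    unfolding poly_ring_def by blast
  with i show "i \<in> {1..m}" by (auto simp: in_keys_iff lookup_add subset_iff)
qed

text \<open>A multiple of the variable \<open>i\<close> has a coefficient at \<open>\<mu>\<close>
  only if \<open>i\<close> occurs in \<open>\<mu>\<close>. Restricting the sum to such
  \<open>i\<close> also keeps the truncated subtraction of exponents a genuine one.\<close>

lemma lookup_koszul:
  assumes "I \<subseteq> {1..m}" "Poly_Mapping.keys \<mu> \<subseteq> {1..m}"
  shows "Poly_Mapping.lookup (koszul m u I) \<mu> =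
    (\<Sum>i\<in>Poly_Mapping.keys \<mu> - I. kos_sign i I * Poly_Mapping.lookup (u (insert i I)) (\<mu> - Poly_Mapping.single i 1))"
proof -
  have "Poly_Mapping.lookup (koszul m u I) \<mu> =
      (\<Sum>i\<in>{1..m} - I. kos_sign i I * Poly_Mapping.lookup (pvar i * u (insert i I)) \<mu>)"
    using assms(1) by (simp add: koszul_def lookup_sum lookup_kos_sign_mult)
  also have "\<dots> = (\<Sum>i\<in>Poly_Mapping.keys \<mu> - I. kos_sign i I * Poly_Mapping.lookup (pvar i * u (insert i I)) \<mu>)"
  proof (rule sum.mono_neutral_right, goal_cases)
    case 2
    then show ?case using assms(2) by auto
  next
    case 3
    show ?case
    proof
      fix i assume "i \<in> {1..m} - I - (Poly_Mapping.keys \<mu> - I)"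
      then have "i \<notin> Poly_Mapping.keys \<mu>" by blast
      then show "kos_sign i I * Poly_Mapping.lookup (pvar i * u (insert i I)) \<mu> = 0"
        using lookup_pvar_mult_notin[of i \<mu> "u (insert i I)"] by simp
    qed
  qed simp
  also have "\<dots> = (\<Sum>i\<in>Poly_Mapping.keys \<mu> - I. kos_sign i I * Poly_Mapping.lookup (u (insert i I)) (\<mu> - Poly_Mapping.single i 1))"
  proof (rule sum.cong[OF refl], goal_cases)
    case (1 i)
    then have "\<mu> = Poly_Mapping.single i 1 + (\<mu> - Poly_Mapping.single i 1)"
      by (intro poly_mapping_eqI) (auto simp: lookup_add lookup_minus lookup_single when_def in_keys_iff)
    then show ?case by (metis lookup_pvar_mult_add)
  qed
  finally show ?thesis .
qed

lemma koszul_poly_ring: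
  assumes "\<And>J. u J \<in> poly_ring m"
  shows "koszul m u I \<in> poly_ring m"
proof -
  have "(kos_sign i I :: 'a mpol) \<in> poly_ring m" for i :: nat and I
    using kos_sign_cases[of i I, where 'a = "'a mpol"] by (metis poly_ring_uminus poly_ring_1)
  then show ?thesis
    unfolding koszul_def by (auto intro!: poly_ring_sum poly_ring_mult poly_ring_pvar assms)
qed

lemma koszul_cong:
  assumes "\<And>J. J \<subseteq> {1..m} \<Longrightarrow> u J = v J"
  shows "koszul m u I = koszul m v I"
  unfolding koszul_def by (auto intro!: sum.cong simp: assms)

text \<open>On cycles the homotopy identity takes this form. The multidegree 0, which offers no
  least vertex, is excluded by the condition on \<open>u {}\<close>.\<close>

lemma koszul_cone:
  fixes u :: "nat set \<Rightarrow> 'k::comm_ring_1 mpol"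
  assumes u: "\<And>J. u J \<in> poly_ring m" and cycle: "\<And>J. koszul m u J = 0"
    and u0: "Poly_Mapping.lookup (u {}) 0 = 0" and I: "I \<subseteq> {1..m}"
  shows "koszul m (cone u) I = u I"
proof (rule poly_mapping_eqI)
  fix \<mu>
  \<comment> \<open>The values of \<open>cone u\<close> outside the subsets of \<open>{1..m}\<close>
    are not controlled, and \<open>koszul\<close> does not read them.\<close>
  define w where "w J = (if J \<subseteq> {1..m} then cone u J else 0)" for J
  have wcone: "koszul m (cone u) I = koszul m w I" by (rule koszul_cong) (simp add: w_def)
  have w: "w J \<in> poly_ring m" for J by (simp add: w_def cone_poly_ring u)
  show "Poly_Mapping.lookup (koszul m (cone u) I) \<mu> = Poly_Mapping.lookup (u I) \<mu>"
  proof (cases "Poly_Mapping.keys \<mu> \<subseteq> {1..m}")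
    case False
    then have "\<mu> \<notin> Poly_Mapping.keys (koszul m w I)" "\<mu> \<notin> Poly_Mapping.keys (u I)"
      using koszul_poly_ring[of w, OF w, of I] u[of I] unfolding poly_ring_def by blast+
    then show ?thesis unfolding wcone by (simp only: in_keys_iff not_not)
  next
    case True
    define i0 where "i0 = Min (Poly_Mapping.keys \<mu> \<union> I)"
    have finI: "finite I" using I by (rule finite_subset) simp
    have lk: "Poly_Mapping.lookup (cone u (insert i I)) (\<mu> - Poly_Mapping.single i 1) =
        (if i0 \<in> insert i I then
          Poly_Mapping.lookup (u (insert i I - {i0})) (\<mu> - Poly_Mapping.single i 1 + Poly_Mapping.single i0 1) else 0)"
      if "i \<in> Poly_Mapping.keys \<mu> - I" for i
    proof -
      have "Poly_Mapping.keys (\<mu> - Poly_Mapping.single i 1) \<union> insert i I = Poly_Mapping.keys \<mu> \<union> I"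
        using that by (auto simp: in_keys_iff lookup_minus lookup_single when_def split: if_splits)
      then show ?thesis using finI by (simp add: lookup_cone i0_def Let_def)
    qed
    have red: "\<mu> - Poly_Mapping.single i 1 + Poly_Mapping.single i 1 = \<mu>" if "i \<in> Poly_Mapping.keys \<mu>" for i
      using that by (intro poly_mapping_eqI) (auto simp: lookup_add lookup_minus lookup_single when_def in_keys_iff)
    note * = lookup_koszul[OF I True, of "cone u"]
    show ?thesis
    proof (cases "Poly_Mapping.keys \<mu> \<union> I = {}")
      case True
      then show ?thesis using * u0 by simp
    next
      case False
      have fin: "finite (Poly_Mapping.keys \<mu> \<union> I)" using finI by simp
      have i0_in: "i0 \<in> Poly_Mapping.keys \<mu> \<union> I" unfolding i0_def using fin False by (rule Min_in)
      have i0_le: "i0 \<le> i" if "i \<in> Poly_Mapping.keys \<mu> \<union> I" for i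
        unfolding i0_def using fin that by (rule Min_le)
      show ?thesis
      proof (cases "i0 \<in> I")
        \<comment> \<open>For \<open>i\<close> other than \<open>i0\<close> the least vertex is
          missing from \<open>insert i I\<close>, so only the term \<open>i = i0\<close>
          survives.\<close>
        case False
        then have k0: "i0 \<in> Poly_Mapping.keys \<mu> - I" using i0_in by blast
        have "{k \<in> I. k < i0} = {}" using i0_le leD by blast
        then have s: "(kos_sign i0 I :: 'k) = 1" by (simp only: kos_sign_def card.empty power_0)
        have "(\<Sum>i\<in>Poly_Mapping.keys \<mu> - I. kos_sign i I * Poly_Mapping.lookup (cone u (insert i I)) (\<mu> - Poly_Mapping.single i 1))
          = (\<Sum>i\<in>{i0}. kos_sign i I * Poly_Mapping.lookup (cone u (insert i I)) (\<mu> - Poly_Mapping.single i 1))"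
          by (rule sum.mono_neutral_right) (use k0 False lk in auto)
        also have "\<dots> = Poly_Mapping.lookup (u I) \<mu>"
          using lk[OF k0] False red k0 s by simp
        finally show ?thesis using * by simp
      next
        \<comment> \<open>The cycle condition is tested at \<open>J\<close> with the exponent raised
          by \<open>i0\<close>. Its term for \<open>i0\<close> is the coefficient sought; the others
          add up to the negative of the coefficient in the boundary of
          \<open>cone u\<close>.\<close>
        case True
        define J where "J = I - {i0}"
        define \<nu> where "\<nu> = \<mu> + Poly_Mapping.single i0 1"
        have IJ: "I = insert i0 J" "i0 \<notin> J" "finite J" using True finI by (auto simp: J_def)
        have k\<nu>: "Poly_Mapping.keys \<nu> = insert i0 (Poly_Mapping.keys \<mu>)"
          by (auto simp: \<nu>_def in_keys_iff lookup_add lookup_single when_def split: if_splits)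
        have kd: "Poly_Mapping.keys \<nu> - J = insert i0 (Poly_Mapping.keys \<mu> - I)"
          using IJ k\<nu> by auto
        have i0m: "i0 \<in> {1..m}" using True I by blast
        have "{k \<in> J. k < i0} = {}" using i0_le leD IJ by blast
        then have s: "(kos_sign i0 J :: 'k) = 1" by (simp only: kos_sign_def card.empty power_0)
        have "0 = (\<Sum>i\<in>Poly_Mapping.keys \<nu> - J. kos_sign i J * Poly_Mapping.lookup (u (insert i J)) (\<nu> - Poly_Mapping.single i 1))"
          using lookup_koszul[of J m \<nu> u] I k\<nu> \<open>Poly_Mapping.keys \<mu> \<subseteq> {1..m}\<close> i0m IJ cycle[of J] by simp
        also have "\<dots> = kos_sign i0 J * Poly_Mapping.lookup (u I) \<mu> +
          (\<Sum>i\<in>Poly_Mapping.keys \<mu> - I. kos_sign i J * Poly_Mapping.lookup (u (insert i J)) (\<nu> - Poly_Mapping.single i 1))"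
          unfolding kd using True by (subst sum.insert) (auto simp: \<nu>_def IJ(1)[symmetric])
        finally have e: "Poly_Mapping.lookup (u I) \<mu> = 
          - (\<Sum>i\<in>Poly_Mapping.keys \<mu> - I. kos_sign i J * Poly_Mapping.lookup (u (insert i J)) (\<nu> - Poly_Mapping.single i 1))"
          unfolding s by (simp add: eq_neg_iff_add_eq_0)
        have "(\<Sum>i\<in>Poly_Mapping.keys \<mu> - I. kos_sign i I * Poly_Mapping.lookup (cone u (insert i I)) (\<mu> - Poly_Mapping.single i 1))
          = (\<Sum>i\<in>Poly_Mapping.keys \<mu> - I. - (kos_sign i J * Poly_Mapping.lookup (u (insert i J)) (\<nu> - Poly_Mapping.single i 1)))"
        proof (rule sum.cong[OF refl])
          fix i assume i: "i \<in> Poly_Mapping.keys \<mu> - I"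
          then have "i0 < i" using i0_le[of i] True by (cases "i = i0") auto
          then have 1: "(kos_sign i I :: 'k) = - kos_sign i J"
            using IJ by (simp add: kos_sign_insert_less)
          have 2: "insert i I - {i0} = insert i J" using \<open>i0 < i\<close> IJ by auto
          have 3: "\<mu> - Poly_Mapping.single i 1 + Poly_Mapping.single i0 1 = \<nu> - Poly_Mapping.single i 1"
            using i by (intro poly_mapping_eqI) (auto simp: \<nu>_def lookup_add lookup_minus lookup_single when_def in_keys_iff)
          show "kos_sign i I * Poly_Mapping.lookup (cone u (insert i I)) (\<mu> - Poly_Mapping.single i 1) =
            - (kos_sign i J * Poly_Mapping.lookup (u (insert i J)) (\<nu> - Poly_Mapping.single i 1))"
            using lk[OF i] True unfolding 1 2 3 by simp
        qed
        then show ?thesis using * e by (simp add: sum_negf)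
      qed
    qed
  qed
qed

text \<open>The part of internal degree \<open>a\<close> of the Koszul complex in position
  \<open>p\<close>, with coefficients in a free module on one generator of degree \<open>c\<close>.
  The wedge indexed by \<open>I\<close> has degree \<open>sum d I\<close>.\<close>

definition koszul_chains ::
  "nat \<Rightarrow> (nat \<Rightarrow> nat) \<Rightarrow> nat \<Rightarrow> nat \<Rightarrow> nat \<Rightarrow> (nat set \<Rightarrow> 'k::comm_ring_1 mpol) set" where
  "koszul_chains m d a c p = {u. \<forall>I. if I \<subseteq> {1..m} \<and> card I = p
     then u I \<in> poly_ring m \<and> (\<forall>\<mu>\<in>Poly_Mapping.keys (u I). weight d \<mu> + sum d I + c = a)
     else u I = 0}"

lemma koszul_chains_poly_ring: "u \<in> koszul_chains m d a c p \<Longrightarrow> u I \<in> poly_ring m"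
  unfolding koszul_chains_def by (cases "I \<subseteq> {1..m} \<and> card I = p") (auto dest!: spec[of _ I])

lemma koszul_chains_weight:
  "u \<in> koszul_chains m d a c p \<Longrightarrow> \<mu> \<in> Poly_Mapping.keys (u I) \<Longrightarrow> weight d \<mu> + sum d I + c = a"
  unfolding koszul_chains_def by (cases "I \<subseteq> {1..m} \<and> card I = p") (auto dest!: spec[of _ I])

lemma koszul_chains_eq_0:
  "u \<in> koszul_chains m d a c p \<Longrightarrow> \<not> (I \<subseteq> {1..m} \<and> card I = p) \<Longrightarrow> u I = 0"
  unfolding koszul_chains_def by (auto dest!: spec[of _ I])

lemma koszul_chainsI:
  assumes "\<And>I. I \<subseteq> {1..m} \<Longrightarrow> card I = p \<Longrightarrow> u I \<in> poly_ring m"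
    and "\<And>I \<mu>. I \<subseteq> {1..m} \<Longrightarrow> card I = p \<Longrightarrow> \<mu> \<in> Poly_Mapping.keys (u I) \<Longrightarrow> weight d \<mu> + sum d I + c = a"
    and "\<And>I. \<not> (I \<subseteq> {1..m} \<and> card I = p) \<Longrightarrow> u I = 0"
  shows "u \<in> koszul_chains m d a c p"
  unfolding koszul_chains_def using assms by auto

lemma koszul_koszul_chains:
  assumes u: "u \<in> koszul_chains m d a c (Suc p)"
  shows "koszul m u \<in> koszul_chains m d a c p"
proof (rule koszul_chainsI)
  fix I
  show "koszul m u I \<in> poly_ring m"
    by (rule koszul_poly_ring) (rule koszul_chains_poly_ring[OF u])
  { assume no: "\<not> (I \<subseteq> {1..m} \<and> card I = p)"
    show "koszul m u I = 0"
    proof (cases "I \<subseteq> {1..m}")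
      case True
      have "u (insert i I) = 0" if "i \<notin> I" for i
        using koszul_chains_eq_0[OF u, of "insert i I"] no True that finite_subset[OF True]
        by (simp add: card_insert_if)
      then show ?thesis by (simp add: koszul_def)
    qed (simp add: koszul_def) }
  fix \<mu> assume I: "I \<subseteq> {1..m}" "card I = p" and \<mu>: "\<mu> \<in> Poly_Mapping.keys (koszul m u I)"
  have finI: "finite I" using I(1) by (rule finite_subset) simp
  have "Poly_Mapping.lookup (koszul m u I) \<mu> \<noteq> 0" using \<mu> by (simp add: in_keys_iff)
  moreover have "Poly_Mapping.lookup (koszul m u I) \<mu> =
      (\<Sum>i\<in>{1..m} - I. kos_sign i I * Poly_Mapping.lookup (pvar i * u (insert i I)) \<mu>)"
    using I(1) by (simp add: koszul_def lookup_sum lookup_kos_sign_mult)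
  ultimately obtain i where i: "i \<in> {1..m} - I"
    "kos_sign i I * Poly_Mapping.lookup (pvar i * u (insert i I)) \<mu> \<noteq> 0"
    by (metis (no_types, lifting) sum.neutral)
  then have "\<mu> \<in> Poly_Mapping.keys (pvar i * u (insert i I))" by (auto simp: in_keys_iff)
  then obtain \<nu> where "\<mu> = Poly_Mapping.single i 1 + \<nu>" "\<nu> \<in> Poly_Mapping.keys (u (insert i I))"
    unfolding pvar_def keys_mult_single by blast
  with koszul_chains_weight[OF u this(2)] i finI
  show "weight d \<mu> + sum d I + c = a" by (simp add: weight_add weight_single)
qed

text \<open>The cone is cut off outside the subsets of \<open>{1..m}\<close>. It keeps the degree,
  since the variable removed from a coefficient is traded for the vertex added to the index set. The
  condition on \<open>u {}\<close> excludes the only homology, the ground field in position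
  0.\<close>

lemma koszul_exact:
  fixes u :: "nat set \<Rightarrow> 'k::comm_ring_1 mpol"
  assumes u: "u \<in> koszul_chains m d a c p" and cycle: "\<And>J. koszul m u J = 0"
    and u0: "Poly_Mapping.lookup (u {}) 0 = 0"
  shows "\<exists>w\<in>koszul_chains m d a c (Suc p). \<forall>I. koszul m w I = u I"
proof
  let ?w = "\<lambda>J. if J \<subseteq> {1..m} then cone u J else 0"
  have uR: "u J \<in> poly_ring m" for J by (rule koszul_chains_poly_ring[OF u])
  show "\<forall>I. koszul m ?w I = u I"
  proof
    fix I
    have "koszul m ?w I = koszul m (cone u) I" by (rule koszul_cong) simp
    also have "\<dots> = u I"
    proof (cases "I \<subseteq> {1..m}")
      case True
      then show ?thesis using koszul_cone[of u, OF uR cycle u0] by blast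
    next
      case False
      then show ?thesis using koszul_chains_eq_0[OF u, of I] by (simp add: koszul_def)
    qed
    finally show "koszul m ?w I = u I" .
  qed
  have key: "\<exists>i\<in>I. \<mu> + Poly_Mapping.single i 1 \<in> Poly_Mapping.keys (u (I - {i}))"
    if "\<mu> \<in> Poly_Mapping.keys (?w I)" for I \<mu>
    using keys_coneD[of I \<mu> u] that finite_subset[of I "{1..m}"] by (auto split: if_splits)
  show "?w \<in> koszul_chains m d a c (Suc p)"
  proof (rule koszul_chainsI)
    fix I assume I: "I \<subseteq> {1..m}" "card I = Suc p"
    then show "?w I \<in> poly_ring m" using cone_poly_ring[OF I(1), of u] uR by simp
    fix \<mu> assume "\<mu> \<in> Poly_Mapping.keys (?w I)"
    then obtain i where i: "i \<in> I" "\<mu> + Poly_Mapping.single i 1 \<in> Poly_Mapping.keys (u (I - {i}))"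
      using key by blast
    from koszul_chains_weight[OF u i(2)] i(1) I
    show "weight d \<mu> + sum d I + c = a"
      using sum.remove[of I i d] finite_subset[of I "{1..m}"] by (simp add: weight_add weight_single)
  next
    fix I assume no: "\<not> (I \<subseteq> {1..m} \<and> card I = Suc p)"
    show "?w I = 0"
    proof (rule ccontr)
      assume "?w I \<noteq> 0"
      then obtain \<mu> where "\<mu> \<in> Poly_Mapping.keys (?w I)" by (metis all_not_in_conv keys_eq_empty)
      then obtain i where i: "i \<in> I" "\<mu> + Poly_Mapping.single i 1 \<in> Poly_Mapping.keys (u (I - {i}))"
        using key by blast
      have "I \<subseteq> {1..m}" using \<open>?w I \<noteq> 0\<close> by (auto split: if_splits)
      then have "card (I - {i}) = p \<Longrightarrow> card I = Suc p"
        using i(1) finite_subset[of I "{1..m}"] by (metis card.remove finite_atLeastAtMost)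
      then have "u (I - {i}) = 0"
        using koszul_chains_eq_0[OF u, of "I - {i}"] no \<open>I \<subseteq> {1..m}\<close> by blast
      with i(2) show False by simp
    qed
  qed
qed

section \<open>Transfer of homology classes between the two ends of a zigzag\<close>

section \<open>Zigzags in a double complex\<close>

text \<open>\<open>v\<close> lowers the first index (Koszul) and \<open>h\<close> the second
  (resolution); they commute rather than anticommute. \<open>v\<close> is exact in positive first
  index, and \<open>v_minimal\<close> says that \<open>h\<close> vanishes on its cokernel in index
  0. \<open>h\<close> is exact strictly between 0 and \<open>r\<close> and injective at
  \<open>r\<close>; its cokernel at 0 is left open.\<close>

locale double_complex =
  fixes G :: "nat \<Rightarrow> nat \<Rightarrow> 'g::ab_group_add set"
    and v :: "'g \<Rightarrow> 'g" and h :: "nat \<Rightarrow> 'g \<Rightarrow> 'g" and r :: nat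
  assumes r_pos: "0 < r"
    and G_diff: "x \<in> G p q \<Longrightarrow> y \<in> G p q \<Longrightarrow> x - y \<in> G p q"
    and v_diff: "v (x - y) = v x - v y"
    and h_diff: "h q (x - y) = h q x - h q y"
    and v_G: "x \<in> G (Suc p) q \<Longrightarrow> v x \<in> G p q"
    and h_G: "q < r \<Longrightarrow> x \<in> G p (Suc q) \<Longrightarrow> h (Suc q) x \<in> G p q"
    and h_v: "h q (v x) = v (h q x)"
    and v_v: "v (v x) = 0"
    and h_h: "Suc q < r \<Longrightarrow> x \<in> G p (Suc (Suc q)) \<Longrightarrow> h (Suc q) (h (Suc (Suc q)) x) = 0"
    and v_exact: "q \<le> r \<Longrightarrow> x \<in> G (Suc p) q \<Longrightarrow> v x = 0 \<Longrightarrow> x \<in> v ` G (Suc (Suc p)) q"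
    and v_minimal: "q < r \<Longrightarrow> x \<in> G 0 (Suc q) \<Longrightarrow> h (Suc q) x \<in> v ` G 1 q"
    and h_exact: "Suc q < r \<Longrightarrow> x \<in> G p (Suc q) \<Longrightarrow> h (Suc q) x = 0 \<Longrightarrow>
      x \<in> h (Suc (Suc q)) ` G p (Suc (Suc q))"
    and h_inj: "x \<in> G p r \<Longrightarrow> h r x = 0 \<Longrightarrow> x = 0"
begin

text \<open>A cycle of total degree \<open>r\<close> in the double complex, up to signs:
  \<open>u k\<close> sits at \<open>(r - k, k)\<close>, and neighbouring entries agree in the
  position which both differentials reach.\<close>

definition zigzag :: "(nat \<Rightarrow> 'g) \<Rightarrow> bool" where
  "zigzag u \<longleftrightarrow> (\<forall>k\<le>r. u k \<in> G (r - k) k) \<and> (\<forall>k<r. h (Suc k) (u (Suc k)) = v (u k))"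

lemma zigzag_diff: "zigzag u \<Longrightarrow> zigzag w \<Longrightarrow> zigzag (\<lambda>q. u q - w q)"
  unfolding zigzag_def by (simp add: G_diff v_diff h_diff)

text \<open>The entries are found with decreasing resolution index. \<open>v_minimal\<close> gives
  the first lift; after that the image under \<open>h\<close> is a \<open>v\<close>-cycle by
  commutation, and \<open>v_exact\<close> lifts it.\<close>

lemma zigzag_from_top:
  assumes e: "e \<in> G 0 r"
  shows "\<exists>u. zigzag u \<and> u r = e"
proof -
  have "\<exists>u. (\<forall>k. 0 \<le> k \<and> k \<le> r \<longrightarrow> u k \<in> G (r - k) k) \<and>
      (\<forall>k. 0 \<le> k \<and> k < r \<longrightarrow> h (Suc k) (u (Suc k)) = v (u k)) \<and> u r = e"
  proof (rule inc_induct[of 0 r "\<lambda>q. \<exists>u. (\<forall>k. q \<le> k \<and> k \<le> r \<longrightarrow> u k \<in> G (r - k) k) \<and>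
      (\<forall>k. q \<le> k \<and> k < r \<longrightarrow> h (Suc k) (u (Suc k)) = v (u k)) \<and> u r = e"], goal_cases)
    case 2
    show ?case by (rule exI[of _ "\<lambda>_. e"]) (use e in auto)
  next
    case (3 q)
    then obtain u where u: "\<And>k. Suc q \<le> k \<Longrightarrow> k \<le> r \<Longrightarrow> u k \<in> G (r - k) k"
      "\<And>k. Suc q \<le> k \<Longrightarrow> k < r \<Longrightarrow> h (Suc k) (u (Suc k)) = v (u k)" "u r = e" by auto
    have "h (Suc q) (u (Suc q)) \<in> v ` G (r - q) q"
    proof (cases "Suc q = r")
      case True
      then show ?thesis using v_minimal[of q e] e u(3) by auto
    next
      case False
      with \<open>q < r\<close> obtain p where p: "r - Suc q = Suc p" by (metis Suc_lessI Suc_diff_Suc)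
      have "v (h (Suc q) (u (Suc q))) = h (Suc q) (h (Suc (Suc q)) (u (Suc (Suc q))))"
        using u(2)[of "Suc q"] False \<open>q < r\<close> by (simp add: h_v)
      also have "h (Suc q) (h (Suc (Suc q)) (u (Suc (Suc q)))) = 0"
        by (rule h_h) (use False \<open>q < r\<close> u(1)[of "Suc (Suc q)"] in auto)
      finally have "v (h (Suc q) (u (Suc q))) = 0" .
      moreover have "r - q = Suc (Suc p)" using p by arith
      ultimately show ?thesis
        using v_exact[of q "h (Suc q) (u (Suc q))" p] h_G[of q "u (Suc q)" "Suc p"] u(1)[of "Suc q"]
          p \<open>q < r\<close> by (simp add: Suc_diff_Suc)
    qed
    then obtain y where y: "y \<in> G (r - q) q" "v y = h (Suc q) (u (Suc q))" by auto
    show ?case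
    proof (rule exI[of _ "u(q := y)"], intro conjI allI impI)
      fix k
      show "(u(q := y)) k \<in> G (r - k) k" if "q \<le> k \<and> k \<le> r"
        using that y u(1)[of k] by (cases "k = q") auto
      show "h (Suc k) ((u(q := y)) (Suc k)) = v ((u(q := y)) k)" if "q \<le> k \<and> k < r"
        using that y u(2)[of k] by (cases "k = q") auto
      show "(u(q := y)) r = e" using u(3) \<open>q < r\<close> by simp
    qed
  qed simp
  then show ?thesis unfolding zigzag_def by auto
qed

text \<open>The hypothesis on \<open>v x\<close> supplies entry 1. Further entries are found with
  increasing resolution index by \<open>h_exact\<close>, because \<open>v (u q)\<close> is an
  \<open>h\<close>-cycle.\<close>

lemma zigzag_from_bottom:
  assumes x: "x \<in> G r 0" "v x \<in> h 1 ` G (r - 1) 1"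
  shows "\<exists>u. zigzag u \<and> u 0 = x"
proof -
  have "\<exists>u. (\<forall>k\<le>r. u k \<in> G (r - k) k) \<and> (\<forall>k<r. h (Suc k) (u (Suc k)) = v (u k)) \<and> u 0 = x"
  proof (rule dec_induct[of 1 r "\<lambda>q. \<exists>u. (\<forall>k\<le>q. u k \<in> G (r - k) k) \<and> (\<forall>k<q. h (Suc k) (u (Suc k)) = v (u k)) \<and> u 0 = x"])
    show "1 \<le> r" using r_pos by simp
    from x obtain y where "y \<in> G (r - 1) 1" "v x = h 1 y" by auto
    then show "\<exists>u. (\<forall>k\<le>1. u k \<in> G (r - k) k) \<and> (\<forall>k<1. h (Suc k) (u (Suc k)) = v (u k)) \<and> u 0 = x"
      by (intro exI[of _ "(\<lambda>_. y)(0 := x)"]) (use x in \<open>auto simp: le_Suc_eq\<close>)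
  next
    fix q assume q: "1 \<le> q" "q < r"
      and "\<exists>u. (\<forall>k\<le>q. u k \<in> G (r - k) k) \<and> (\<forall>k<q. h (Suc k) (u (Suc k)) = v (u k)) \<and> u 0 = x"
    then obtain u where u: "\<And>k. k \<le> q \<Longrightarrow> u k \<in> G (r - k) k"
      "\<And>k. k < q \<Longrightarrow> h (Suc k) (u (Suc k)) = v (u k)" "u 0 = x" by auto
    obtain q' where q': "q = Suc q'" using q(1) by (cases q) auto
    have "h (Suc q') (v (u q)) = 0" using u(2)[of q'] q' by (simp add: h_v v_v)
    moreover have "v (u q) \<in> G (r - Suc q) q"
      by (rule v_G) (use q u(1)[of q] in \<open>simp add: Suc_diff_Suc\<close>)
    ultimately have "v (u q) \<in> h (Suc q) ` G (r - Suc q) (Suc q)"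
      using h_exact[of q' "v (u q)"] q q' by auto
    then obtain y where "y \<in> G (r - Suc q) (Suc q)" "v (u q) = h (Suc q) y" by auto
    then show "\<exists>u. (\<forall>k\<le>Suc q. u k \<in> G (r - k) k) \<and> (\<forall>k<Suc q. h (Suc k) (u (Suc k)) = v (u k)) \<and> u 0 = x"
      by (intro exI[of _ "u(Suc q := y)"]) (use u in \<open>auto simp: le_Suc_eq less_Suc_eq\<close>)
  qed
  then show ?thesis unfolding zigzag_def by blast
qed

text \<open>Corrections are passed down: once \<open>u (Suc q)\<close> is a
  \<open>v\<close>-boundary up to an element killed by \<open>h\<close>, the entry
  \<open>u q\<close> is a \<open>v\<close>-boundary up to an \<open>h\<close>-image.\<close>

lemma zigzag_bottom_boundary:
  assumes u: "zigzag u" and top: "u r \<in> v ` G 1 r"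
  shows "\<exists>w\<in>G (Suc r) 0. \<exists>x\<in>G r 1. u 0 = v w + h 1 x"
proof -
  have uG: "u k \<in> G (r - k) k" if "k \<le> r" for k using u that by (simp add: zigzag_def)
  have uh: "h (Suc k) (u (Suc k)) = v (u k)" if "k < r" for k using u that by (simp add: zigzag_def)
  have step: "\<exists>w'\<in>G (Suc (r - q)) q. u q - h (Suc q) w = v w'"
    if w: "w \<in> G (r - q) (Suc q)" "h (Suc q) (u (Suc q) - v w) = 0" and "q < r" for q w
  proof -
    from \<open>q < r\<close> obtain p where p: "r - q = Suc p" by (metis Suc_diff_Suc)
    have "v (u q - h (Suc q) w) = 0"
      using w(2) uh[OF \<open>q < r\<close>] by (simp add: h_diff v_diff h_v)
    moreover have "u q - h (Suc q) w \<in> G (Suc p) q"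
      using G_diff[OF uG[of q] h_G[OF \<open>q < r\<close> w(1)]] \<open>q < r\<close> p by simp
    ultimately have "u q - h (Suc q) w \<in> v ` G (Suc (Suc p)) q"
      using v_exact[of q _ p] \<open>q < r\<close> by simp
    then show ?thesis unfolding p by auto
  qed
  \<comment> \<open>The induction ends at index 1, since \<open>h 0\<close> is not a differential of
    the complex; the passage to index 0 needs only \<open>step\<close>.\<close>
  have "\<exists>w\<in>G (Suc (r - 1)) 1. h 1 (u 1 - v w) = 0"
  proof (rule inc_induct[of 1 r "\<lambda>q. \<exists>w\<in>G (Suc (r - q)) q. h q (u q - v w) = 0"])
    show "1 \<le> r" using r_pos by simp
    have "h r 0 = 0" using h_diff[of r 0 0] by simp
    moreover obtain x where "x \<in> G 1 r" "u r = v x" using top by auto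
    ultimately show "\<exists>w\<in>G (Suc (r - r)) r. h r (u r - v w) = 0" by (intro bexI[of _ x]) auto
  next
    fix q assume q: "1 \<le> q" "q < r" and "\<exists>w\<in>G (Suc (r - Suc q)) (Suc q). h (Suc q) (u (Suc q) - v w) = 0"
    then obtain w where w: "w \<in> G (r - q) (Suc q)" "h (Suc q) (u (Suc q) - v w) = 0"
      by (auto simp: Suc_diff_Suc)
    obtain w' where w': "w' \<in> G (Suc (r - q)) q" "u q - h (Suc q) w = v w'" using step[OF w q(2)] by auto
    obtain q' where q': "q = Suc q'" using q(1) by (cases q) auto
    have "u q - v w' = h (Suc q) w" using w'(2) by (simp add: algebra_simps)
    then have "h q (u q - v w') = 0" using h_h[of q' w] w(1) q q' by simp
    then show "\<exists>w\<in>G (Suc (r - q)) q. h q (u q - v w) = 0" using w'(1) by blast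
  qed
  then obtain w where w: "w \<in> G (r - 0) (Suc 0)" "h (Suc 0) (u (Suc 0) - v w) = 0" using r_pos by auto
  obtain w' where "w' \<in> G (Suc (r - 0)) 0" "u 0 - h (Suc 0) w = v w'" using step[OF w r_pos] by auto
  then have "w' \<in> G (Suc r) 0" "u 0 = v w' + h 1 w" by (simp_all add: algebra_simps)
  then show ?thesis using w(1) by auto
qed

text \<open>The same transfer upwards, with exactness of \<open>h\<close> in place of that of
  \<open>v\<close>.\<close>

lemma zigzag_top_boundary:
  assumes u: "zigzag u" and bot: "x \<in> G r 1" "u 0 = v w + h 1 x"
  shows "u r \<in> v ` G 1 r"
proof -
  have uG: "u k \<in> G (r - k) k" if "k \<le> r" for k using u that by (simp add: zigzag_def)
  have uh: "h (Suc k) (u (Suc k)) = v (u k)" if "k < r" for k using u that by (simp add: zigzag_def)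
  have step: "h (Suc q) (u (Suc q) - v x) = 0 \<and> u (Suc q) - v x \<in> G (r - Suc q) (Suc q)"
    if x: "x \<in> G (r - q) (Suc q)" "v (u q - h (Suc q) x) = 0" and "q < r" for q x
    using that uh[of q] uG[of "Suc q"] v_G[of x "r - Suc q" "Suc q"]
    by (simp add: h_diff v_diff h_v G_diff Suc_diff_Suc)
  \<comment> \<open>The induction stops at \<open>r - 1\<close>: at the end of the zigzag
    injectivity of \<open>h r\<close> takes over from exactness.\<close>
  have "\<exists>x\<in>G (r - (r - 1)) (Suc (r - 1)). v (u (r - 1) - h (Suc (r - 1)) x) = 0"
  proof (rule dec_induct[of 0 "r - 1" "\<lambda>q. \<exists>x\<in>G (r - q) (Suc q). v (u q - h (Suc q) x) = 0"])
    have "v (u 0 - h 1 x) = 0" using bot(2) by (simp add: v_v)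
    then show "\<exists>x\<in>G (r - 0) (Suc 0). v (u 0 - h (Suc 0) x) = 0" using bot(1) by auto
  next
    fix q assume "q < r - 1" and "\<exists>x\<in>G (r - q) (Suc q). v (u q - h (Suc q) x) = 0"
    then obtain x where x: "x \<in> G (r - q) (Suc q)" "v (u q - h (Suc q) x) = 0" by auto
    have "q < r" "Suc q < r" using \<open>q < r - 1\<close> by auto
    with step[OF x] h_exact[of q "u (Suc q) - v x" "r - Suc q"]
    obtain x' where "x' \<in> G (r - Suc q) (Suc (Suc q))" "u (Suc q) - v x = h (Suc (Suc q)) x'" by auto
    moreover from this(2) have "u (Suc q) - h (Suc (Suc q)) x' = v x" by (simp add: algebra_simps)
    ultimately show "\<exists>x\<in>G (r - Suc q) (Suc (Suc q)). v (u (Suc q) - h (Suc (Suc q)) x) = 0"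
      by (auto simp: v_v intro!: bexI[of _ x'])
  qed simp
  then obtain x where x: "x \<in> G (r - (r - 1)) (Suc (r - 1))" "v (u (r - 1) - h (Suc (r - 1)) x) = 0" by auto
  from step[OF x] r_pos h_inj[of "u r - v x" 0] have "u r = v x" by simp
  then show ?thesis using x(1) r_pos by auto
qed

end

section \<open>Homogeneous components and the part of fixed degree of the double complex\<close>

section \<open>The double complex of a graded resolution\<close>

text \<open>Serves as projection to a homogeneous component, the predicate being a condition on the
  degree.\<close>

definition restrict_keys :: "('a \<Rightarrow> bool) \<Rightarrow> ('a \<Rightarrow>\<^sub>0 'b::zero) \<Rightarrow> 'a \<Rightarrow>\<^sub>0 'b" where
  "restrict_keys P p = Poly_Mapping.mapp (\<lambda>\<mu> c. if P \<mu> then c else 0) p"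

lemma lookup_restrict_keys:
  "Poly_Mapping.lookup (restrict_keys P p) \<mu> = (if P \<mu> then Poly_Mapping.lookup p \<mu> else 0)"
  by (auto simp: restrict_keys_def lookup_mapp in_keys_iff when_def)

lemma keys_restrict_keys: "Poly_Mapping.keys (restrict_keys P p) = {\<mu> \<in> Poly_Mapping.keys p. P \<mu>}"
  by (auto simp: in_keys_iff lookup_restrict_keys split: if_splits)

lemma restrict_keys_0 [simp]: "restrict_keys P 0 = 0"
  by (rule poly_mapping_eqI) (simp add: lookup_restrict_keys)

lemma restrict_keys_add:
  "restrict_keys P (p + q) = restrict_keys P p + restrict_keys P (q :: 'a \<Rightarrow>\<^sub>0 'b::monoid_add)"
  by (rule poly_mapping_eqI) (simp add: lookup_restrict_keys lookup_add)

lemma restrict_keys_sum: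
  "restrict_keys P (\<Sum>i\<in>A. f i :: 'a \<Rightarrow>\<^sub>0 'b::comm_monoid_add) = (\<Sum>i\<in>A. restrict_keys P (f i))"
  by (induction A rule: infinite_finite_induct) (simp_all add: restrict_keys_add)

lemma restrict_keys_self: "(\<And>\<mu>. \<mu> \<in> Poly_Mapping.keys p \<Longrightarrow> P \<mu>) \<Longrightarrow> restrict_keys P p = p"
  by (rule poly_mapping_eqI) (auto simp: lookup_restrict_keys in_keys_iff)

text \<open>A homogeneous factor shifts all degrees equally, so multiplication by it commutes with
  taking components; \<open>Q\<close> and \<open>P\<close> are the degree conditions before and
  after the shift.\<close>

lemma restrict_keys_mult:
  fixes q p :: "'a::monoid_add \<Rightarrow>\<^sub>0 'b::comm_ring_1"
  assumes "\<And>\<mu> \<nu>. \<mu> \<in> Poly_Mapping.keys q \<Longrightarrow> P (\<mu> + \<nu>) \<longleftrightarrow> Q \<nu>"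
  shows "restrict_keys P (q * p) = q * restrict_keys Q p"
proof -
  let ?p1 = "restrict_keys Q p" and ?p2 = "restrict_keys (\<lambda>\<nu>. \<not> Q \<nu>) p"
  have p: "p = ?p1 + ?p2"
    by (rule poly_mapping_eqI) (simp add: lookup_add lookup_restrict_keys)
  have "restrict_keys P (q * ?p1) = q * ?p1"
    by (rule restrict_keys_self) (use keys_mult[of q ?p1] assms in \<open>auto simp: keys_restrict_keys\<close>)
  moreover have "restrict_keys P (q * ?p2) = 0"
  proof -
    have "Poly_Mapping.keys (restrict_keys P (q * ?p2)) = {}"
      using keys_mult[of q ?p2] assms by (auto simp: keys_restrict_keys)
    then show ?thesis by simp
  qed
  ultimately show ?thesis
    by (metis p distrib_left restrict_keys_add add.right_neutral)
qed

lemma koszul_chains_diff: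
  assumes "u \<in> koszul_chains m d a c p" "w \<in> koszul_chains m d a c p"
  shows "(\<lambda>I. u I - w I) \<in> koszul_chains m d a c p"
proof (rule koszul_chainsI)
  fix I
  show "u I - w I \<in> poly_ring m"
    by (intro poly_ring_diff koszul_chains_poly_ring[OF assms(1)] koszul_chains_poly_ring[OF assms(2)])
  show "u I - w I = 0" if "\<not> (I \<subseteq> {1..m} \<and> card I = p)"
    using koszul_chains_eq_0[OF assms(1) that] koszul_chains_eq_0[OF assms(2) that] by simp
  fix \<mu> assume "\<mu> \<in> Poly_Mapping.keys (u I - w I)"
  then have "\<mu> \<in> Poly_Mapping.keys (u I) \<or> \<mu> \<in> Poly_Mapping.keys (w I)"
    by (auto simp: in_keys_iff lookup_minus)
  then show "weight d \<mu> + sum d I + c = a"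
    using koszul_chains_weight[OF assms(1)] koszul_chains_weight[OF assms(2)] by blast
qed

lemma koszul_eq_0_of_chains_0:
  assumes "u \<in> koszul_chains m d a c 0"
  shows "koszul m u I = 0"
proof (cases "I \<subseteq> {1..m}")
  case True
  have "u (insert i I) = 0" for i
    using koszul_chains_eq_0[OF assms, of "insert i I"] finite_subset[OF True]
    by (cases "i \<in> I") (auto simp: card_insert_if card_eq_0_iff)
  then show ?thesis by (simp add: koszul_def)
qed (simp add: koszul_def)

text \<open>One internal degree \<open>a\<close> is fixed: all maps preserve it, and the last
  syzygies are counted degree by degree.\<close>

locale graded_resolution =
  fixes m :: nat and d \<beta> :: "nat \<Rightarrow> nat" and C :: "nat \<Rightarrow> nat \<Rightarrow> nat"
    and M :: "nat \<Rightarrow> nat \<Rightarrow> nat \<Rightarrow> 'k::field_char_0 mpol" and a :: nat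
  assumes resolution: "minimal_graded_resolution m d \<beta> C M" and m_ge_2: "2 \<le> m"
begin

lemmas resolution_unfolded = resolution[unfolded minimal_graded_resolution_def]

text \<open>The part of degree \<open>a\<close> of Koszul position \<open>p\<close> tensored with
  step \<open>q\<close> of the resolution: \<open>I\<close> is the Koszul index and \<open>j\<close>
  the basis index. Values outside the index ranges are 0, so that equality of elements is equality
  of functions.\<close>

definition G :: "nat \<Rightarrow> nat \<Rightarrow> (nat set \<Rightarrow> nat \<Rightarrow> 'k mpol) set" where
  "G p q = {u. \<forall>j. if j \<in> {1..\<beta> q} then (\<lambda>I. u I j) \<in> koszul_chains m d a (C j q) p else (\<forall>I. u I j = 0)}"

definition vmap :: "(nat set \<Rightarrow> nat \<Rightarrow> 'k mpol) \<Rightarrow> nat set \<Rightarrow> nat \<Rightarrow> 'k mpol" where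
  "vmap u = (\<lambda>I j. koszul m (\<lambda>J. u J j) I)"

definition hmap :: "nat \<Rightarrow> (nat set \<Rightarrow> nat \<Rightarrow> 'k mpol) \<Rightarrow> nat set \<Rightarrow> nat \<Rightarrow> 'k mpol" where
  "hmap q u = (\<lambda>I. matrix_map (\<beta> (q - 1)) (\<beta> q) (M q) (u I))"

lemma GI:
  assumes "\<And>j. j \<in> {1..\<beta> q} \<Longrightarrow> (\<lambda>I. u I j) \<in> koszul_chains m d a (C j q) p"
    and "\<And>j I. j \<notin> {1..\<beta> q} \<Longrightarrow> u I j = 0"
  shows "u \<in> G p q"
  unfolding G_def using assms by auto

lemma GD1: "u \<in> G p q \<Longrightarrow> j \<in> {1..\<beta> q} \<Longrightarrow> (\<lambda>I. u I j) \<in> koszul_chains m d a (C j q) p"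
  unfolding G_def by (auto dest!: spec[of _ j])

lemma GD2: "u \<in> G p q \<Longrightarrow> j \<notin> {1..\<beta> q} \<Longrightarrow> u I j = 0"
  unfolding G_def by (auto dest!: spec[of _ j])

lemma G_weight:
  "u \<in> G p q \<Longrightarrow> \<mu> \<in> Poly_Mapping.keys (u I j) \<Longrightarrow> weight d \<mu> + sum d I + C j q = a"
  using koszul_chains_weight[OF GD1, of u p q j \<mu> I] GD2[of u p q j I] by (cases "j \<in> {1..\<beta> q}") auto

lemma G_eq_0: "u \<in> G p q \<Longrightarrow> \<not> (I \<subseteq> {1..m} \<and> card I = p) \<Longrightarrow> u I j = 0"
  using koszul_chains_eq_0[OF GD1, of u p q j I] GD2[of u p q j I] by (cases "j \<in> {1..\<beta> q}") auto

lemma G_poly_ring: "u \<in> G p q \<Longrightarrow> u I j \<in> poly_ring m"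
  using koszul_chains_poly_ring[OF GD1, of u p q j I] GD2[of u p q j I]
  by (cases "j \<in> {1..\<beta> q}") auto

lemma G_free_module: "u \<in> G p q \<Longrightarrow> u I \<in> free_module m (\<beta> q)"
  unfolding free_module_def using G_poly_ring[of u p q I] GD2[of u p q _ I] by auto

lemma M_entry:
  assumes "Suc q < m" "r \<in> {1..\<beta> q}" "j \<in> {1..\<beta> (Suc q)}"
  shows "M (Suc q) r j \<in> poly_ring m"
    and "\<mu> \<in> Poly_Mapping.keys (M (Suc q) r j) \<Longrightarrow> weight d \<mu> + C r q = C j (Suc q)"
    and "Poly_Mapping.lookup (M (Suc q) r j) 0 = 0"
proof -
  have "\<forall>i\<in>{1..m - 1}. \<forall>r\<in>{1..\<beta> (i - 1)}. \<forall>j\<in>{1..\<beta> i}.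
        M i r j \<in> poly_ring m \<and>
        (\<forall>\<mu>\<in>Poly_Mapping.keys (M i r j). weight d \<mu> + C r (i - 1) = C j i) \<and>
        Poly_Mapping.lookup (M i r j) 0 = 0"
    by (rule resolution_unfolded[THEN conjunct2, THEN conjunct2, THEN conjunct1])
  from bspec[OF this, of "Suc q"] assms
  show "M (Suc q) r j \<in> poly_ring m"
    and "\<mu> \<in> Poly_Mapping.keys (M (Suc q) r j) \<Longrightarrow> weight d \<mu> + C r q = C j (Suc q)"
    and "Poly_Mapping.lookup (M (Suc q) r j) 0 = 0" by auto
qed

lemma exact_0: "{w \<in> free_module m (\<beta> 0). monomial_curve_map d (w 1) = 0} =
    matrix_map (\<beta> 0) (\<beta> 1) (M 1) ` free_module m (\<beta> 1)"
  by (rule resolution_unfolded[THEN conjunct2, THEN conjunct2, THEN conjunct2, THEN conjunct1])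

lemma exact_Suc: "Suc q < m - 1 \<Longrightarrow>
    {w \<in> free_module m (\<beta> (Suc q)). matrix_map (\<beta> q) (\<beta> (Suc q)) (M (Suc q)) w = (\<lambda>_. 0)} =
    matrix_map (\<beta> (Suc q)) (\<beta> (Suc (Suc q))) (M (Suc (Suc q))) ` free_module m (\<beta> (Suc (Suc q)))"
  using resolution_unfolded[THEN conjunct2, THEN conjunct2, THEN conjunct2, THEN conjunct2, THEN conjunct1,
      THEN spec[of _ "Suc q"]] by simp

lemma exact_last: "{w \<in> free_module m (\<beta> (m - 1)).
    matrix_map (\<beta> (m - 2)) (\<beta> (m - 1)) (M (m - 1)) w = (\<lambda>_. 0)} = {\<lambda>_. 0}"
  by (rule resolution_unfolded[THEN conjunct2, THEN conjunct2, THEN conjunct2, THEN conjunct2, THEN conjunct2])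

lemma beta_0: "\<beta> 0 = 1" and C_0: "C 1 0 = 0"
  using resolution_unfolded[THEN conjunct1] resolution_unfolded[THEN conjunct2, THEN conjunct1] by auto

text \<open>Exactness of the resolution yields a preimage for each \<open>I\<close>, not necessarily
  homogeneous. Its component of the right degree is still a preimage, because the matrix entries are
  homogeneous.\<close>

lemma hmap_lift:
  assumes q: "Suc q < m" and x: "x \<in> G p q"
    and im: "\<And>I. x I \<in> matrix_map (\<beta> q) (\<beta> (Suc q)) (M (Suc q)) ` free_module m (\<beta> (Suc q))"
  shows "x \<in> hmap (Suc q) ` G p (Suc q)"
proof -
  have "\<forall>I. \<exists>y. y \<in> free_module m (\<beta> (Suc q)) \<and> x I = matrix_map (\<beta> q) (\<beta> (Suc q)) (M (Suc q)) y"
    using im by blast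
  then obtain Y where Y: "\<And>I. Y I \<in> free_module m (\<beta> (Suc q))"
    "\<And>I. x I = matrix_map (\<beta> q) (\<beta> (Suc q)) (M (Suc q)) (Y I)" by metis
  define y where "y I j = (if I \<subseteq> {1..m} \<and> card I = p
    then restrict_keys (\<lambda>\<nu>. weight d \<nu> + sum d I + C j (Suc q) = a) (Y I j) else 0)" for I j
  have "y \<in> G p (Suc q)"
  proof (rule GI)
    fix j I assume "j \<notin> {1..\<beta> (Suc q)}"
    then have "Y I j = 0" using Y(1)[of I] unfolding free_module_def by (auto dest!: spec[of _ j])
    then show "y I j = 0" by (simp add: y_def)
  next
    fix j assume j: "j \<in> {1..\<beta> (Suc q)}"
    show "(\<lambda>I. y I j) \<in> koszul_chains m d a (C j (Suc q)) p"
    proof (rule koszul_chainsI)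
      fix I assume I: "I \<subseteq> {1..m}" "card I = p"
      have "Y I j \<in> poly_ring m" using Y(1)[of I] j unfolding free_module_def by (auto dest!: spec[of _ j])
      then show "y I j \<in> poly_ring m" using I by (auto simp: y_def poly_ring_def keys_restrict_keys)
      show "weight d \<mu> + sum d I + C j (Suc q) = a" if "\<mu> \<in> Poly_Mapping.keys (y I j)" for \<mu>
        using that I by (simp add: y_def keys_restrict_keys)
    qed (auto simp: y_def)
  qed
  moreover have "x = hmap (Suc q) y"
  proof (intro ext)
    fix I r
    show "x I r = hmap (Suc q) y I r"
    proof (cases "(I \<subseteq> {1..m} \<and> card I = p) \<and> r \<in> {1..\<beta> q}")
      case False
      show ?thesis
      proof (cases "r \<in> {1..\<beta> q}")
        case True
        with False have no: "\<not> (I \<subseteq> {1..m} \<and> card I = p)" by blast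
        then have "y I j = 0" for j unfolding y_def by (rule if_not_P)
        then show ?thesis using G_eq_0[OF x no, of r] by (simp add: hmap_def matrix_map_def)
      next
        case False
        then show ?thesis using GD2[OF x False, of I] by (auto simp: hmap_def matrix_map_def)
      qed
    next
      case True
      let ?P = "\<lambda>\<mu>. weight d \<mu> + sum d I + C r q = a"
      have "x I r = restrict_keys ?P (x I r)"
        by (rule restrict_keys_self[symmetric]) (rule G_weight[OF x])
      also have "\<dots> = (\<Sum>j=1..\<beta> (Suc q). restrict_keys ?P (M (Suc q) r j * Y I j))"
        using True by (simp add: Y(2)[of I] matrix_map_def restrict_keys_sum)
      also have "\<dots> = (\<Sum>j=1..\<beta> (Suc q). M (Suc q) r j * y I j)"
      proof (rule sum.cong[OF refl])
        fix j assume j: "j \<in> {1..\<beta> (Suc q)}"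
        have "restrict_keys ?P (M (Suc q) r j * Y I j) = M (Suc q) r j *
          restrict_keys (\<lambda>\<nu>. weight d \<nu> + sum d I + C j (Suc q) = a) (Y I j)"
        proof (rule restrict_keys_mult)
          fix \<mu> \<nu> assume "\<mu> \<in> Poly_Mapping.keys (M (Suc q) r j)"
          from M_entry(2)[OF q _ j this] True
          show "?P (\<mu> + \<nu>) \<longleftrightarrow> weight d \<nu> + sum d I + C j (Suc q) = a"
            by (auto simp: weight_add)
        qed
        then show "restrict_keys ?P (M (Suc q) r j * Y I j) = M (Suc q) r j * y I j"
          using True by (simp add: y_def)
      qed
      also have "\<dots> = hmap (Suc q) y I r" using True by (simp add: hmap_def matrix_map_def)
      finally show ?thesis .
    qed
  qed
  ultimately show ?thesis by blast
qed

lemma hmap_G: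
  assumes q: "Suc q < m" and x: "x \<in> G p (Suc q)"
  shows "hmap (Suc q) x \<in> G p q"
proof (rule GI)
  fix r assume r: "r \<in> {1..\<beta> q}"
  then have h: "hmap (Suc q) x I r = (\<Sum>j=1..\<beta> (Suc q). M (Suc q) r j * x I j)" for I
    by (simp add: hmap_def matrix_map_def)
  show "(\<lambda>I. hmap (Suc q) x I r) \<in> koszul_chains m d a (C r q) p"
  proof (rule koszul_chainsI)
    fix I
    show "hmap (Suc q) x I r \<in> poly_ring m"
      unfolding h by (intro poly_ring_sum poly_ring_mult M_entry(1)[OF q r] G_poly_ring[OF x])
    show "hmap (Suc q) x I r = 0" if "\<not> (I \<subseteq> {1..m} \<and> card I = p)"
      unfolding h by (rule sum.neutral) (use G_eq_0[OF x that] in auto)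
    fix \<mu> assume "\<mu> \<in> Poly_Mapping.keys (hmap (Suc q) x I r)"
    then obtain j where j: "j \<in> {1..\<beta> (Suc q)}" "\<mu> \<in> Poly_Mapping.keys (M (Suc q) r j * x I j)"
      unfolding h using keys_sum by fast
    then obtain \<nu> \<kappa> where *: "\<mu> = \<nu> + \<kappa>" "\<nu> \<in> Poly_Mapping.keys (M (Suc q) r j)" "\<kappa> \<in> Poly_Mapping.keys (x I j)"
      using keys_mult by fast
    show "weight d \<mu> + sum d I + C r q = a"
      using M_entry(2)[OF q r j(1) *(2)] G_weight[OF x *(3)] by (simp add: *(1) weight_add)
  qed
qed (auto simp: hmap_def matrix_map_def)

text \<open>Tensoring with a free module gives a direct sum of shifted Koszul complexes, so
  exactness applies in each coordinate.\<close>

lemma vmap_lift: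
  assumes x: "x \<in> G p q" and "vmap x = 0" and c: "\<And>j. Poly_Mapping.lookup (x {} j) 0 = 0"
  shows "x \<in> vmap ` G (Suc p) q"
proof -
  have "\<exists>w\<in>koszul_chains m d a (C j q) (Suc p). \<forall>I. koszul m w I = x I j" if "j \<in> {1..\<beta> q}" for j
  proof (rule koszul_exact[OF GD1[OF x that] _ c])
    show "koszul m (\<lambda>I. x I j) J = 0" for J
      using fun_cong[OF fun_cong[OF assms(2)], of J j] by (simp add: vmap_def)
  qed
  then obtain w where w: "\<And>j. j \<in> {1..\<beta> q} \<Longrightarrow> w j \<in> koszul_chains m d a (C j q) (Suc p)"
    "\<And>j I. j \<in> {1..\<beta> q} \<Longrightarrow> koszul m (w j) I = x I j" by metis
  define y where "y I j = (if j \<in> {1..\<beta> q} then w j I else 0)" for I j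
  have "y \<in> G (Suc p) q" by (rule GI) (use w(1) in \<open>auto simp: y_def\<close>)
  moreover have "x = vmap y"
  proof (intro ext)
    fix I j
    show "x I j = vmap y I j"
      using w(2)[of j I] GD2[OF x, of j I] by (cases "j \<in> {1..\<beta> q}") (auto simp: vmap_def y_def)
  qed
  ultimately show ?thesis by blast
qed

sublocale double_complex G vmap hmap "m - 1"
proof
  show "0 < m - 1" using m_ge_2 by simp
  fix x y :: "nat set \<Rightarrow> nat \<Rightarrow> 'k mpol" and p q :: nat
  { assume "x \<in> G p q" "y \<in> G p q"
    then show "x - y \<in> G p q"
      using koszul_chains_diff[OF GD1 GD1] by (intro GI) (auto simp: GD2) }
  show "vmap (x - y) = vmap x - vmap y"
    by (intro ext) (simp add: vmap_def koszul_diff)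
  show "hmap q (x - y) = hmap q x - hmap q y"
    by (intro ext) (simp add: hmap_def matrix_map_def algebra_simps sum_subtractf)
  { assume "x \<in> G (Suc p) q"
    then show "vmap x \<in> G p q"
      by (intro GI) (auto simp: GD2 vmap_def intro!: koszul_koszul_chains GD1) }
  { assume "q < m - 1" "x \<in> G p (Suc q)"
    then show "hmap (Suc q) x \<in> G p q" by (intro hmap_G) auto }
  show "hmap q (vmap x) = vmap (hmap q x)"
  proof (intro ext)
    fix I j
    show "hmap q (vmap x) I j = vmap (hmap q x) I j"
      by (cases "j \<in> {1..\<beta> (q - 1)}")
        (auto simp: hmap_def vmap_def matrix_map_def koszul_sum koszul_mult)
  qed
  show "vmap (vmap x) = 0"
    by (intro ext) (simp add: vmap_def koszul_koszul)
  { assume q: "Suc q < m - 1" and x: "x \<in> G p (Suc (Suc q))"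
    show "hmap (Suc q) (hmap (Suc (Suc q)) x) = 0"
    proof
      fix I
      have "matrix_map (\<beta> (Suc q)) (\<beta> (Suc (Suc q))) (M (Suc (Suc q))) (x I) \<in>
          {w \<in> free_module m (\<beta> (Suc q)). matrix_map (\<beta> q) (\<beta> (Suc q)) (M (Suc q)) w = (\<lambda>_. 0)}"
        unfolding exact_Suc[OF q] by (rule imageI) (rule G_free_module[OF x])
      then show "hmap (Suc q) (hmap (Suc (Suc q)) x) I = 0 I"
        by (simp add: hmap_def zero_fun_def)
    qed }
  { assume "q \<le> m - 1" and x: "x \<in> G (Suc p) q" and v: "vmap x = 0"
    show "x \<in> vmap ` G (Suc (Suc p)) q"
      by (rule vmap_lift[OF x v]) (use G_eq_0[OF x, of "{}"] in auto) }
  { assume q: "q < m - 1" and x: "x \<in> G 0 (Suc q)"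
    have y: "hmap (Suc q) x \<in> G 0 q" using q x by (intro hmap_G) auto
    have "hmap (Suc q) x \<in> vmap ` G (Suc 0) q"
    proof (rule vmap_lift[OF y])
      show "vmap (hmap (Suc q) x) = 0"
      proof (intro ext)
        fix I j
        show "vmap (hmap (Suc q) x) I j = 0 I j"
          using koszul_eq_0_of_chains_0[OF GD1[OF y, of j], of I] GD2[OF y, of j]
          by (cases "j \<in> {1..\<beta> q}") (auto simp: vmap_def)
      qed
      fix r
      \<comment> \<open>Minimality of the resolution enters here: the entries of
        \<open>M (Suc q)\<close> have no constant term, hence neither has the image.\<close>
      have "0 \<notin> Poly_Mapping.keys (M (Suc q) r j * x {} j)"
        if "r \<in> {1..\<beta> q}" "j \<in> {1..\<beta> (Suc q)}" for j
      proof
        assume "0 \<in> Poly_Mapping.keys (M (Suc q) r j * x {} j)"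
        then obtain \<mu> \<nu> where *: "\<mu> \<in> Poly_Mapping.keys (M (Suc q) r j)" "0 = \<mu> + \<nu>"
          using keys_mult by fast
        have "\<mu> = 0"
          by (rule poly_mapping_eqI) (use arg_cong[OF *(2), of Poly_Mapping.lookup] in \<open>auto simp: lookup_add fun_eq_iff\<close>)
        then show False using M_entry(3)[of q r j] that q * by (auto simp: in_keys_iff)
      qed
      then show "Poly_Mapping.lookup (hmap (Suc q) x {} r) 0 = 0"
        by (auto simp: hmap_def matrix_map_def lookup_sum in_keys_iff)
    qed
    then show "hmap (Suc q) x \<in> vmap ` G 1 q" by simp }
  { assume q: "Suc q < m - 1" and x: "x \<in> G p (Suc q)" and h: "hmap (Suc q) x = 0"
    show "x \<in> hmap (Suc (Suc q)) ` G p (Suc (Suc q))"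
    proof (rule hmap_lift)
      fix I
      have "matrix_map (\<beta> q) (\<beta> (Suc q)) (M (Suc q)) (x I) = (\<lambda>_. 0)"
        using fun_cong[OF h, of I] by (simp add: hmap_def zero_fun_def)
      then show "x I \<in> matrix_map (\<beta> (Suc q)) (\<beta> (Suc (Suc q))) (M (Suc (Suc q))) ` free_module m (\<beta> (Suc (Suc q)))"
        using exact_Suc[OF q] G_free_module[OF x, of I] by blast
    qed (use q x in auto) }
  { assume x: "x \<in> G p (m - 1)" and h: "hmap (m - 1) x = 0"
    show "x = 0"
    proof
      fix I
      have "matrix_map (\<beta> (m - 2)) (\<beta> (m - 1)) (M (m - 1)) (x I) = (\<lambda>_. 0)"
        using fun_cong[OF h, of I] by (simp add: hmap_def zero_fun_def numeral_2_eq_2)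
      then have "x I = (\<lambda>_. 0)" using exact_last G_free_module[OF x, of I] by blast
      then show "x I = 0 I" by (simp add: zero_fun_def)
    qed }
qed

end

section \<open>Values in the semigroup ring, membership in the semigroup, pseudo-Frobenius
  numbers\<close>

section \<open>Degrees of the last syzygies\<close>

text \<open>The value at the point with all coordinates 1. A homogeneous polynomial of weight
  \<open>w\<close> is sent by \<open>monomial_curve_map\<close> to this value times the power
  \<open>w\<close> of the variable, so it records the class in the semigroup ring.\<close>

definition coeff_sum :: "('a \<Rightarrow>\<^sub>0 'b::comm_monoid_add) \<Rightarrow> 'b" where
  "coeff_sum p = (\<Sum>\<mu>\<in>Poly_Mapping.keys p. Poly_Mapping.lookup p \<mu>)"

lemma coeff_sum_eq:
  assumes "finite A" "Poly_Mapping.keys p \<subseteq> A"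
  shows "coeff_sum p = (\<Sum>\<mu>\<in>A. Poly_Mapping.lookup p \<mu>)"
  unfolding coeff_sum_def by (rule sum.mono_neutral_left) (use assms in \<open>auto simp: in_keys_iff\<close>)

lemma coeff_sum_0 [simp]: "coeff_sum 0 = 0"
  by (simp add: coeff_sum_def)

lemma coeff_sum_single [simp]: "coeff_sum (Poly_Mapping.single \<mu> c) = c"
  by (simp add: coeff_sum_def)

lemma coeff_sum_add: "coeff_sum (p + q) = coeff_sum p + coeff_sum q"
proof -
  let ?A = "Poly_Mapping.keys p \<union> Poly_Mapping.keys q"
  show ?thesis using keys_add[of p q]
    by (simp add: coeff_sum_eq[of ?A] lookup_add sum.distrib)
qed

lemma coeff_sum_uminus: "coeff_sum (- p) = - coeff_sum (p :: 'a \<Rightarrow>\<^sub>0 'b::ab_group_add)"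
  by (metis coeff_sum_add coeff_sum_0 add.right_inverse minus_unique)

lemma coeff_sum_diff: "coeff_sum (p - q) = coeff_sum p - coeff_sum (q :: 'a \<Rightarrow>\<^sub>0 'b::ab_group_add)"
  by (metis coeff_sum_add coeff_sum_uminus diff_conv_add_uminus)

lemma coeff_sum_sum: "coeff_sum (\<Sum>i\<in>A. f i) = (\<Sum>i\<in>A. coeff_sum (f i))"
  by (induction A rule: infinite_finite_induct) (simp_all add: coeff_sum_add)

lemma coeff_sum_pvar_mult: "coeff_sum (pvar i * p) = coeff_sum p"
proof -
  have "coeff_sum (pvar i * p) =
      (\<Sum>\<mu>\<in>(+) (Poly_Mapping.single i 1) ` Poly_Mapping.keys p. Poly_Mapping.lookup (pvar i * p) \<mu>)"
    by (simp only: coeff_sum_def pvar_def keys_mult_single)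
  also have "\<dots> = coeff_sum p"
    by (subst sum.reindex) (simp_all add: coeff_sum_def lookup_pvar_mult_add[unfolded One_nat_def] o_def)
  finally show ?thesis .
qed

lemma coeff_sum_kos_sign_mult: "coeff_sum (kos_sign i I * p) = kos_sign i I * coeff_sum (p :: 'k::comm_ring_1 mpol)"
  using kos_sign_cases[of i I, where 'a = "'k mpol"]
  unfolding kos_sign_def
  by (cases "even (card {k \<in> I. k < i})") (simp_all add: coeff_sum_uminus)

lemma coeff_sum_const_mult:
  "coeff_sum (Poly_Mapping.single 0 c * p) = c * coeff_sum (p :: 'k::field mpol)"
proof -
  have l: "Poly_Mapping.lookup (Poly_Mapping.single 0 c * p) \<mu> = c * Poly_Mapping.lookup p \<mu>" for \<mu>
    using lookup_single_mult_add[of 0 c p \<mu>] by simp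
  have "Poly_Mapping.keys (Poly_Mapping.single 0 c * p) \<subseteq> Poly_Mapping.keys p"
    by (auto simp: in_keys_iff l)
  then show ?thesis by (simp add: coeff_sum_eq[of "Poly_Mapping.keys p"] l sum_distrib_left)
qed

lemma prod_monom_1:
  "(\<Prod>i\<in>A. monom (1 :: 'k::comm_ring_1) (f i)) = monom 1 (\<Sum>i\<in>A. f i)"
  by (induction A rule: infinite_finite_induct) (simp_all add: mult_monom)

lemma monomial_curve_map_homogeneous:
  assumes "\<And>\<mu>. \<mu> \<in> Poly_Mapping.keys p \<Longrightarrow> weight d \<mu> = w"
  shows "monomial_curve_map d p = monom (coeff_sum p) w"
proof -
  have "monomial_curve_map d p = (\<Sum>\<mu>\<in>Poly_Mapping.keys p. monom (Poly_Mapping.lookup p \<mu>) w)"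
    unfolding monomial_curve_map_def
  proof (rule sum.cong[OF refl])
    fix \<mu> assume "\<mu> \<in> Poly_Mapping.keys p"
    then have "(\<Sum>i\<in>Poly_Mapping.keys \<mu>. d i * Poly_Mapping.lookup \<mu> i) = w"
      using assms by (simp add: weight_def mult.commute)
    then show "[:Poly_Mapping.lookup p \<mu>:] * (\<Prod>i\<in>Poly_Mapping.keys \<mu>. monom 1 (d i) ^ Poly_Mapping.lookup \<mu> i)
      = monom (Poly_Mapping.lookup p \<mu>) w"
      by (simp add: monom_power prod_monom_1 smult_monom)
  qed
  also have "\<dots> = monom (coeff_sum p) w"
    by (simp add: coeff_sum_def monom_sum)
  finally show ?thesis .
qed

lemma semigroup_of_iff_weight:
  "int n \<in> semigroup_of m d \<longleftrightarrow> (\<exists>\<mu>. Poly_Mapping.keys \<mu> \<subseteq> {1..m} \<and> weight d \<mu> = n)"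
proof
  assume "int n \<in> semigroup_of m d"
  then obtain x :: "nat \<Rightarrow> nat" where x: "n = (\<Sum>i=1..m. x i * d i)"
    unfolding semigroup_of_def using of_nat_eq_iff by blast
  define \<mu> where "\<mu> = (\<Sum>i=1..m. Poly_Mapping.single i (x i))"
  have l: "Poly_Mapping.lookup \<mu> j = (if j \<in> {1..m} then x j else 0)" for j
    unfolding \<mu>_def by (simp add: lookup_sum lookup_single when_def)
  have k: "Poly_Mapping.keys \<mu> \<subseteq> {1..m}" by (auto simp: in_keys_iff l split: if_splits)
  then have "weight d \<mu> = n" by (simp add: weight_eq_sum[of "{1..m}"] l x)
  with k show "\<exists>\<mu>. Poly_Mapping.keys \<mu> \<subseteq> {1..m} \<and> weight d \<mu> = n" by blast
next
  assume "\<exists>\<mu>. Poly_Mapping.keys \<mu> \<subseteq> {1..m} \<and> weight d \<mu> = n"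
  then obtain \<mu> where "Poly_Mapping.keys \<mu> \<subseteq> {1..m}" "weight d \<mu> = n" by blast
  then have "n = (\<Sum>i=1..m. Poly_Mapping.lookup \<mu> i * d i)" using weight_eq_sum[of "{1..m}"] by simp
  then show "int n \<in> semigroup_of m d" unfolding semigroup_of_def by blast
qed

lemma semigroup_of_nonneg: "x \<in> semigroup_of m d \<Longrightarrow> 0 \<le> x"
  unfolding semigroup_of_def by (auto intro: sum_nonneg)

lemma semigroup_of_add:
  assumes "x \<in> semigroup_of m d" "y \<in> semigroup_of m d"
  shows "x + y \<in> semigroup_of m d"
proof -
  from assms obtain a b :: "nat \<Rightarrow> nat" where
    "x = int (\<Sum>i=1..m. a i * d i)" "y = int (\<Sum>i=1..m. b i * d i)"
    unfolding semigroup_of_def by blast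
  then have "x + y = int (\<Sum>i=1..m. (a i + b i) * d i)"
    by (simp add: algebra_simps sum.distrib)
  then show ?thesis unfolding semigroup_of_def by (intro CollectI exI[of _ "\<lambda>i. a i + b i"]) auto
qed

lemma semigroup_of_0: "0 \<in> semigroup_of m d"
  unfolding semigroup_of_def by (intro CollectI exI[of _ "\<lambda>_. 0"]) auto

lemma semigroup_of_generator:
  assumes "i \<in> {1..m}"
  shows "int (d i) \<in> semigroup_of m d"
  unfolding semigroup_of_iff_weight
  by (rule exI[of _ "Poly_Mapping.single i 1"]) (use assms in \<open>auto simp: weight_single\<close>)

text \<open>A nonzero element of the semigroup is a generator plus another element, so the condition
  need only be tested on generators.\<close>

lemma pseudo_frobenius_iff:
  assumes "\<And>i. i \<in> {1..m} \<Longrightarrow> 0 < d i"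
  shows "x \<in> pseudo_frobenius (semigroup_of m d) \<longleftrightarrow>
    x \<notin> semigroup_of m d \<and> (\<forall>i\<in>{1..m}. x + int (d i) \<in> semigroup_of m d)"
proof -
  let ?S = "semigroup_of m d"
  have "x + s \<in> ?S" if gens: "\<forall>i\<in>{1..m}. x + int (d i) \<in> ?S" and s: "s \<in> ?S" "s \<noteq> 0" for s
  proof -
    obtain a :: "nat \<Rightarrow> nat" where a: "s = int (\<Sum>i=1..m. a i * d i)"
      using s(1) unfolding semigroup_of_def by blast
    with s(2) obtain i where i: "i \<in> {1..m}" "a i \<noteq> 0"
      by (metis (no_types, lifting) mult_zero_left of_nat_0 sum.neutral)
    define b where "b = a(i := a i - 1)"
    have "(\<Sum>k=1..m. a k * d k) = a i * d i + (\<Sum>k\<in>{1..m} - {i}. b k * d k)"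
      using i by (subst sum.remove[of _ i]) (auto simp: b_def intro!: sum.cong)
    also have "a i * d i = d i + b i * d i" using i by (cases "a i") (auto simp: b_def)
    also have "d i + b i * d i + (\<Sum>k\<in>{1..m} - {i}. b k * d k) = d i + (\<Sum>k=1..m. b k * d k)"
      using i by (subst (2) sum.remove[of _ i]) auto
    finally have "x + s = (x + int (d i)) + int (\<Sum>k=1..m. b k * d k)" using a by simp
    moreover have "int (\<Sum>k=1..m. b k * d k) \<in> ?S" unfolding semigroup_of_def by blast
    ultimately show ?thesis using gens i(1) semigroup_of_add by metis
  qed
  moreover have "int (d i) \<in> ?S - {0}" if "i \<in> {1..m}" for i
    using assms[OF that] semigroup_of_generator[OF that] by auto
  ultimately show ?thesis unfolding pseudo_frobenius_def by blast
qed

section \<open>Koszul homology of the semigroup ring in position \<open>m - 1\<close>\<close>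

context graded_resolution
begin

text \<open>A coordinate for the homology class of a chain in position \<open>m - 1\<close>, read
  off at the facet without vertex 1, where the orientation sign is 1. The second argument 1 is the
  only basis index of step 0.\<close>

definition facet_sum :: "(nat set \<Rightarrow> nat \<Rightarrow> 'k mpol) \<Rightarrow> 'k" where
  "facet_sum x = coeff_sum (x ({1..m} - {1}) 1)"

text \<open>The first differential has the defining ideal of the monomial curve as its image, and
  homogeneity reduces membership in the kernel of the curve map to one scalar.\<close>

lemma G_0_image_iff:
  assumes "y \<in> G p 0"
  shows "y I \<in> matrix_map (\<beta> 0) (\<beta> 1) (M 1) ` free_module m (\<beta> 1) \<longleftrightarrow> coeff_sum (y I 1) = 0"
proof -
  have "monomial_curve_map d (y I 1) = monom (coeff_sum (y I 1)) (a - sum d I)"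
  proof (rule monomial_curve_map_homogeneous)
    fix \<mu> assume "\<mu> \<in> Poly_Mapping.keys (y I 1)"
    from G_weight[OF assms this] show "weight d \<mu> = a - sum d I" using C_0 by simp
  qed
  then show ?thesis unfolding exact_0[symmetric]
    using G_free_module[OF assms] by (simp add: monom_eq_0_iff)
qed

lemma hmap_image_coeff_sum:
  assumes "y \<in> G p 1"
  shows "coeff_sum (hmap 1 y I 1) = 0"
proof -
  have "hmap 1 y \<in> G p 0" using hmap_G[of 0 y p] assms m_ge_2 by simp
  moreover have "hmap 1 y I \<in> matrix_map (\<beta> 0) (\<beta> 1) (M 1) ` free_module m (\<beta> 1)"
    unfolding hmap_def using G_free_module[OF assms] by simp
  ultimately show ?thesis using G_0_image_iff by blast
qed

lemma G_0_in_hmap_image: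
  assumes "x \<in> G p 0" "\<And>I. I \<subseteq> {1..m} \<Longrightarrow> card I = p \<Longrightarrow> coeff_sum (x I 1) = 0"
  shows "x \<in> hmap 1 ` G p 1"
proof -
  have "coeff_sum (x I 1) = 0" for I
    using assms(2)[of I] G_eq_0[OF assms(1), of I 1]
    by (cases "I \<subseteq> {1..m} \<and> card I = p") auto
  then show ?thesis
    using hmap_lift[of 0 x p] assms(1) m_ge_2 G_0_image_iff[OF assms(1)] by simp
qed

lemma coeff_sum_vmap:
  assumes "I \<subseteq> {1..m}"
  shows "coeff_sum (vmap x I j) = (\<Sum>i\<in>{1..m} - I. kos_sign i I * coeff_sum (x (insert i I) j))"
  using assms by (simp add: vmap_def koszul_def coeff_sum_sum coeff_sum_kos_sign_mult coeff_sum_pvar_mult)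

lemma kos_sign_1: "kos_sign 1 ({1..m} - J) = (1 :: 'k)"
proof -
  have "{k \<in> {1..m} - J. k < 1} = {}" by auto
  then show ?thesis by (simp only: kos_sign_def card.empty power_0)
qed

text \<open>The Koszul cycle condition, tested on the faces with two vertices removed, makes all
  facet coefficients agree up to the orientation sign.\<close>

lemma facet_coeff_sum:
  assumes x: "vmap x \<in> hmap 1 ` G p 1" and i: "i \<in> {1..m}"
  shows "coeff_sum (x ({1..m} - {i}) 1) = kos_sign i ({1..m} - {i}) * facet_sum x"
proof (cases "i = 1")
  case True
  then show ?thesis by (simp only: facet_sum_def kos_sign_1 mult_1)
next
  case False
  let ?I = "{1..m} - {1, i}"
  have compl: "{1..m} - ?I = {1, i}" using i m_ge_2 by auto
  have ins: "insert 1 ?I = {1..m} - {i}" "insert i ?I = {1..m} - {1}" using i m_ge_2 False by auto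
  have "kos_sign i (insert 1 ?I) = (- kos_sign i ?I :: 'k)"
    by (rule kos_sign_insert_less) (use i False in auto)
  then have s: "kos_sign i ?I = (- kos_sign i ({1..m} - {i}) :: 'k)" unfolding ins by simp
  have "0 = coeff_sum (vmap x ?I 1)" using x hmap_image_coeff_sum by auto
  also have "\<dots> = (\<Sum>k\<in>{1, i}. kos_sign k ?I * coeff_sum (x (insert k ?I) 1))"
    by (subst coeff_sum_vmap) (auto simp only: compl)
  also have "\<dots> = coeff_sum (x ({1..m} - {i}) 1) - kos_sign i ({1..m} - {i}) * facet_sum x"
    using False ins s kos_sign_1[of "{1, i}"] by (simp add: facet_sum_def)
  finally show ?thesis by simp
qed

lemma zigzag_vmap_image: "zigzag u \<Longrightarrow> vmap (u 0) \<in> hmap 1 ` G (m - 2) 1"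
proof -
  assume u: "zigzag u"
  have "u 1 \<in> G (m - 1 - 1) 1" "hmap (Suc 0) (u (Suc 0)) = vmap (u 0)"
    using u m_ge_2 unfolding zigzag_def by auto
  then show ?thesis by (auto simp: numeral_2_eq_2 intro!: image_eqI[of _ _ "u 1"])
qed

lemma vmap_constant_term: "Poly_Mapping.lookup (vmap w I j) 0 = 0"
proof (cases "I \<subseteq> {1..m}")
  case True
  then show ?thesis unfolding vmap_def by (subst lookup_koszul) auto
qed (simp add: vmap_def koszul_def)

text \<open>All facet coefficients agree up to sign, so the vanishing of one makes the chain zero
  over the semigroup ring.\<close>

lemma facet_sum_0_imp_hmap:
  assumes x: "x \<in> G (m - 1) 0" "vmap x \<in> hmap 1 ` G p 1" "facet_sum x = 0"
  shows "x \<in> hmap 1 ` G (m - 1) 1"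
proof (rule G_0_in_hmap_image[OF x(1)])
  fix I assume I: "I \<subseteq> {1..m}" "card I = m - 1"
  then have "card ({1..m} - I) = 1" using m_ge_2 by (simp add: card_Diff_subset finite_subset)
  then obtain i where "{1..m} - I = {i}" by (auto simp: card_1_singleton_iff)
  with I have "I = {1..m} - {i}" "i \<in> {1..m}" by blast+
  then show "coeff_sum (x I 1) = 0" using facet_coeff_sum[OF x(2), of i] x(3) by simp
qed

text \<open>A chain vanishing over the semigroup ring at the bottom makes the top entry a Koszul
  boundary, and boundaries have no constant term.\<close>

lemma zigzag_facet_sum_0:
  assumes u: "zigzag u" and "facet_sum (u 0) = 0"
  shows "Poly_Mapping.lookup (u (m - 1) {} j) 0 = 0"
proof -
  have "u 0 \<in> G (m - 1) 0" using u unfolding zigzag_def by (auto dest!: spec[of _ 0])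
  from facet_sum_0_imp_hmap[OF this zigzag_vmap_image[OF u] assms(2)]
  obtain y where "y \<in> G (m - 1) 1" "u 0 = vmap 0 + hmap 1 y"
    using v_diff[of 0 0] by auto
  from zigzag_top_boundary[OF u this] show ?thesis using vmap_constant_term by auto
qed

lemma facet_sum_hmap: "y \<in> G p 1 \<Longrightarrow> facet_sum (hmap 1 y) = 0"
  unfolding facet_sum_def by (rule hmap_image_coeff_sum)

lemma facet_sum_diff: "facet_sum (x - y) = facet_sum x - facet_sum y"
  by (simp add: facet_sum_def coeff_sum_diff)

lemma facet_sum_vmap: "facet_sum (vmap w) = coeff_sum (w {1..m} 1)"
proof -
  have "1 \<in> {1..m}" using m_ge_2 by simp
  then have *: "{1..m} - ({1..m} - {1}) = {1}" "insert 1 ({1..m} - {1}) = {1..m}" by blast+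
  have "facet_sum (vmap w) = (\<Sum>i\<in>{1}. kos_sign i ({1..m} - {1}) * coeff_sum (w (insert i ({1..m} - {1})) 1))"
    unfolding facet_sum_def by (subst coeff_sum_vmap) (auto simp only: *)
  then show ?thesis unfolding kos_sign_1 *(2) by (simp only: sum.insert sum.empty finite.emptyI empty_iff
      not_False_eq_True kos_sign_1 *(2) mult_1 add_0_right)
qed

lemma Sigma_gen_eq: "Sigma_gen m d = int (sum d {1..m})"
  by (simp add: Sigma_gen_def)

text \<open>The class dies for one of two reasons. If \<open>int a - Sigma_gen m d\<close> lies in
  the semigroup, a monomial of that weight on the full index set has a boundary with any prescribed
  facet sum. Otherwise adding some \<open>d i\<close> still leaves the semigroup, and the facet
  without \<open>i\<close> carries no monomial.\<close>

lemma not_pseudo_frobenius_facet_sum: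
  assumes d: "\<And>i. i \<in> {1..m} \<Longrightarrow> 0 < d i"
    and npf: "int a - Sigma_gen m d \<notin> pseudo_frobenius (semigroup_of m d)"
    and x: "x \<in> G (m - 1) 0" "vmap x \<in> hmap 1 ` G p 1"
  shows "\<exists>w\<in>G m 0. facet_sum (x - vmap w) = 0"
proof (cases "int a - Sigma_gen m d \<in> semigroup_of m d")
  case True
  have le: "sum d {1..m} \<le> a" using semigroup_of_nonneg[OF True] unfolding Sigma_gen_eq by linarith
  then have "int (a - sum d {1..m}) \<in> semigroup_of m d" using True unfolding Sigma_gen_eq by (simp only: of_nat_diff)
  then obtain \<mu> where \<mu>: "Poly_Mapping.keys \<mu> \<subseteq> {1..m}" "weight d \<mu> = a - sum d {1..m}"
    unfolding semigroup_of_iff_weight by blast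
  define w :: "nat set \<Rightarrow> nat \<Rightarrow> 'k mpol" where
    "w I j = (if I = {1..m} \<and> j = 1 then Poly_Mapping.single \<mu> (facet_sum x) else 0)" for I j
  have "w \<in> G m 0"
  proof (rule GI)
    fix j assume "j \<in> {1..\<beta> 0}"
    then have j: "j = 1" using beta_0 by simp
    show "(\<lambda>I. w I j) \<in> koszul_chains m d a (C j 0) m"
    proof (rule koszul_chainsI)
      fix I :: "nat set" assume I: "I \<subseteq> {1..m}" "card I = m"
      then have I: "I = {1..m}" by (intro card_subset_eq) auto
      show "w I j \<in> poly_ring m" using \<mu>(1) by (auto simp: w_def poly_ring_def)
      show "weight d \<nu> + sum d I + C j 0 = a" if "\<nu> \<in> Poly_Mapping.keys (w I j)" for \<nu>
        using that \<mu>(2) le I j C_0 by (auto simp: w_def split: if_splits)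
    qed (auto simp: w_def)
  qed (use beta_0 in \<open>auto simp: w_def\<close>)
  moreover have "facet_sum (x - vmap w) = 0"
    by (simp add: facet_sum_diff facet_sum_vmap w_def)
  ultimately show ?thesis by blast
next
  case False
  then obtain i where i: "i \<in> {1..m}" "int a - Sigma_gen m d + int (d i) \<notin> semigroup_of m d"
    using npf pseudo_frobenius_iff[of m d "int a - Sigma_gen m d"] d by blast
  have "Poly_Mapping.keys (x ({1..m} - {i}) 1) = {}"
  proof (rule ccontr)
    assume "Poly_Mapping.keys (x ({1..m} - {i}) 1) \<noteq> {}"
    then obtain \<mu> where \<mu>: "\<mu> \<in> Poly_Mapping.keys (x ({1..m} - {i}) 1)" by blast
    then have "Poly_Mapping.keys \<mu> \<subseteq> {1..m}"
      using G_poly_ring[OF x(1)] unfolding poly_ring_def by blast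
    then have "int (weight d \<mu>) \<in> semigroup_of m d" unfolding semigroup_of_iff_weight by blast
    moreover have "int (weight d \<mu>) = int a - Sigma_gen m d + int (d i)"
      using G_weight[OF x(1) \<mu>] sum.remove[OF finite_atLeastAtMost i(1), of d]
      unfolding Sigma_gen_eq C_0 by linarith
    ultimately show False using i(2) by simp
  qed
  then have "kos_sign i ({1..m} - {i}) * facet_sum x = 0"
    using facet_coeff_sum[OF x(2) i(1)] by simp
  moreover have "kos_sign i ({1..m} - {i}) \<noteq> (0 :: 'k)"
    using kos_sign_sq[of i "{1..m} - {i}", where 'a = 'k] by auto
  ultimately have "facet_sum x = 0" by simp
  moreover have "0 \<in> G m 0" using G_diff[OF x(1) x(1)]
    by (intro GI koszul_chainsI) auto
  ultimately show ?thesis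
    by (intro bexI[of _ 0]) (auto simp: facet_sum_diff facet_sum_vmap)
qed

lemma basis_zigzag:
  assumes "j \<in> {1..\<beta> (m - 1)}" "C j (m - 1) = a"
  shows "\<exists>u. zigzag u \<and> u (m - 1) = (\<lambda>I k. if I = {} \<and> k = j then 1 else 0)"
proof (rule zigzag_from_top, rule GI)
  fix k assume "k \<in> {1..\<beta> (m - 1)}"
  show "(\<lambda>I. if I = {} \<and> k = j then 1 else 0) \<in> koszul_chains m d a (C k (m - 1)) 0"
    by (rule koszul_chainsI) (use assms in \<open>auto simp: weight_0 finite_subset card_eq_0_iff split: if_splits\<close>)
qed (use assms in auto)

text \<open>The zigzag above a basis vector has the constant 1 as its top entry. If the class at the
  bottom died, this entry would be a Koszul boundary and have no constant term.\<close>

lemma last_degree_pseudo_frobenius: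
  assumes d: "\<And>i. i \<in> {1..m} \<Longrightarrow> 0 < d i"
    and j: "j \<in> {1..\<beta> (m - 1)}" "C j (m - 1) = a"
  shows "int a - Sigma_gen m d \<in> pseudo_frobenius (semigroup_of m d)"
proof (rule ccontr)
  assume npf: "int a - Sigma_gen m d \<notin> pseudo_frobenius (semigroup_of m d)"
  obtain u where u: "zigzag u" "u (m - 1) = (\<lambda>I k. if I = {} \<and> k = j then 1 else 0)"
    using basis_zigzag[OF j] by blast
  have u0: "u 0 \<in> G (m - 1) 0" using u(1) unfolding zigzag_def by (auto dest!: spec[of _ 0])
  obtain w where w: "w \<in> G m 0" "facet_sum (u 0 - vmap w) = 0"
    using not_pseudo_frobenius_facet_sum[OF d npf u0 zigzag_vmap_image[OF u(1)]] by blast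
  have "u 0 - vmap w \<in> hmap 1 ` G (m - 1) 1"
  proof (rule facet_sum_0_imp_hmap[OF _ _ w(2)])
    show "u 0 - vmap w \<in> G (m - 1) 0"
      using u0 v_G[of w "m - 1" 0] w(1) m_ge_2 by (intro G_diff) auto
    show "vmap (u 0 - vmap w) \<in> hmap 1 ` G (m - 2) 1"
      using zigzag_vmap_image[OF u(1)] unfolding v_diff v_v diff_zero .
  qed
  then obtain y where y: "y \<in> G (m - 1) 1" "u 0 - vmap w = hmap 1 y" by blast
  have "u 0 = vmap w + hmap 1 y" using y(2) by (simp add: algebra_simps)
  from zigzag_top_boundary[OF u(1) y(1) this]
  have "Poly_Mapping.lookup (u (m - 1) {} j) 0 = 0" using vmap_constant_term by auto
  then show False unfolding u(2) by simp
qed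

text \<open>Scalars are constant polynomials, of weight 0. They allow linear combinations of
  zigzags, which the group structure of the double complex alone does not.\<close>

lemma zigzag_scale:
  assumes "zigzag u"
  shows "zigzag (\<lambda>q I j. Poly_Mapping.single 0 c * u q I j)"
proof -
  have ch: "(\<lambda>I. Poly_Mapping.single 0 c * w I) \<in> koszul_chains m d a b p"
    if w: "w \<in> koszul_chains m d a b p" for w b p
  proof (rule koszul_chainsI)
    fix I
    have l: "Poly_Mapping.lookup (Poly_Mapping.single 0 c * w I) \<mu> = c * Poly_Mapping.lookup (w I) \<mu>" for \<mu>
      using lookup_single_mult_add[of 0 c "w I" \<mu>] by simp
    show "Poly_Mapping.single 0 c * w I \<in> poly_ring m"
      by (rule poly_ring_mult[OF _ koszul_chains_poly_ring[OF w]]) (simp add: poly_ring_def)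
    show "weight d \<mu> + sum d I + b = a" if "\<mu> \<in> Poly_Mapping.keys (Poly_Mapping.single 0 c * w I)" for \<mu>
      using that koszul_chains_weight[OF w, of \<mu> I] by (auto simp: in_keys_iff l)
    show "Poly_Mapping.single 0 c * w I = 0" if "\<not> (I \<subseteq> {1..m} \<and> card I = p)"
      using koszul_chains_eq_0[OF w that] by simp
  qed
  have "(\<lambda>I j. Poly_Mapping.single 0 c * w I j) \<in> G p q" if w: "w \<in> G p q" for w p q
    by (rule GI) (auto intro!: ch[OF GD1[OF w]] simp: GD2[OF w])
  moreover have "hmap q (\<lambda>I j. Poly_Mapping.single 0 c * w I j) =
      (\<lambda>I j. Poly_Mapping.single 0 c * hmap q w I j)" for q w
    by (intro ext) (simp add: hmap_def matrix_map_def sum_distrib_left algebra_simps)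
  moreover have "vmap (\<lambda>I j. Poly_Mapping.single 0 c * w I j) =
      (\<lambda>I j. Poly_Mapping.single 0 c * vmap w I j)" for w
    by (intro ext) (simp add: vmap_def koszul_mult)
  ultimately show ?thesis using assms unfolding zigzag_def by simp
qed

text \<open>The bottom homology is at most one-dimensional: cross-multiplying two zigzags by each
  other's facet sums cancels the bottom class, while the top entry keeps a nonzero constant
  coefficient at the basis vector \<open>j\<close>.\<close>

lemma last_degree_unique:
  assumes j: "j \<in> {1..\<beta> (m - 1)}" "C j (m - 1) = a" and k: "k \<in> {1..\<beta> (m - 1)}" "C k (m - 1) = a"
  shows "j = k"
proof (rule ccontr)
  assume "j \<noteq> k"
  obtain u where u: "zigzag u" "u (m - 1) = (\<lambda>I i. if I = {} \<and> i = j then 1 else 0)"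
    using basis_zigzag[OF j] by blast
  obtain w where w: "zigzag w" "w (m - 1) = (\<lambda>I i. if I = {} \<and> i = k then 1 else 0)"
    using basis_zigzag[OF k] by blast
  have w_ne: "facet_sum (w 0) \<noteq> 0" using zigzag_facet_sum_0[OF w(1), of k] w(2) by auto
  define z where "z = (\<lambda>q. (\<lambda>I i. Poly_Mapping.single 0 (facet_sum (w 0)) * u q I i) -
    (\<lambda>I i. Poly_Mapping.single 0 (facet_sum (u 0)) * w q I i))"
  have "zigzag z" unfolding z_def by (intro zigzag_diff zigzag_scale u(1) w(1))
  moreover have "facet_sum (z 0) = 0"
    unfolding z_def facet_sum_diff by (simp add: facet_sum_def coeff_sum_const_mult)
  ultimately have "Poly_Mapping.lookup (z (m - 1) {} j) 0 = 0" by (rule zigzag_facet_sum_0)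
  then show False using w_ne \<open>j \<noteq> k\<close> unfolding z_def fun_diff_def u(2) w(2)
    by (simp add: lookup_minus)
qed

text \<open>The pseudo-Frobenius condition provides a monomial on every facet and none on the full
  index set. Hence there is a cycle with facet sum 1 that is not a boundary; its zigzag must have a
  constant term at the top.\<close>

lemma last_degree_exists:
  assumes d: "\<And>i. i \<in> {1..m} \<Longrightarrow> 0 < d i"
    and pf: "int a - Sigma_gen m d \<in> pseudo_frobenius (semigroup_of m d)"
  shows "\<exists>j\<in>{1..\<beta> (m - 1)}. C j (m - 1) = a"
proof -
  have S: "int a - Sigma_gen m d \<notin> semigroup_of m d"
    "\<And>i. i \<in> {1..m} \<Longrightarrow> int a - Sigma_gen m d + int (d i) \<in> semigroup_of m d"
    using pf pseudo_frobenius_iff[of m d "int a - Sigma_gen m d"] d by blast+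
  have "\<exists>\<mu>. Poly_Mapping.keys \<mu> \<subseteq> {1..m} \<and> weight d \<mu> + sum d ({1..m} - {i}) = a" if i: "i \<in> {1..m}" for i
  proof -
    have e: "int a - Sigma_gen m d + int (d i) = int a - int (sum d ({1..m} - {i}))"
      using sum.remove[OF finite_atLeastAtMost i, of d] unfolding Sigma_gen_eq by linarith
    then have le: "sum d ({1..m} - {i}) \<le> a" using semigroup_of_nonneg[OF S(2)[OF i]] by linarith
    then have "int (a - sum d ({1..m} - {i})) \<in> semigroup_of m d"
      using S(2)[OF i] e by (simp only: of_nat_diff)
    then obtain \<nu> where "Poly_Mapping.keys \<nu> \<subseteq> {1..m}" "weight d \<nu> = a - sum d ({1..m} - {i})"
      unfolding semigroup_of_iff_weight by blast
    with le show ?thesis by (intro exI[of _ \<nu>]) linarith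
  qed
  then obtain \<mu> where \<mu>: "\<And>i. i \<in> {1..m} \<Longrightarrow> Poly_Mapping.keys (\<mu> i) \<subseteq> {1..m}"
    "\<And>i. i \<in> {1..m} \<Longrightarrow> weight d (\<mu> i) + sum d ({1..m} - {i}) = a" by metis
  \<comment> \<open>The orientation signs as coefficients make this a cycle over the semigroup ring,
    whatever monomials of the right weight are chosen.\<close>
  define x :: "nat set \<Rightarrow> nat \<Rightarrow> 'k mpol" where
    "x I j = (\<Sum>i\<in>{1..m}. if I = {1..m} - {i} \<and> j = 1
       then Poly_Mapping.single (\<mu> i) (kos_sign i ({1..m} - {i})) else 0)" for I j
  have x_facet: "x ({1..m} - {i}) 1 = Poly_Mapping.single (\<mu> i) (kos_sign i ({1..m} - {i}))"
    if "i \<in> {1..m}" for i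
  proof -
    have "x ({1..m} - {i}) 1 = (\<Sum>k\<in>{1..m}. if k = i
       then Poly_Mapping.single (\<mu> i) (kos_sign i ({1..m} - {i})) else 0)"
      unfolding x_def
    proof (rule sum.cong[OF refl])
      fix k assume "k \<in> {1..m}"
      then have "{1..m} - {i} = {1..m} - {k} \<longleftrightarrow> k = i" using that by blast
      then show "(if {1..m} - {i} = {1..m} - {k} \<and> 1 = (1::nat)
          then Poly_Mapping.single (\<mu> k) (kos_sign k ({1..m} - {k})) else 0) =
        (if k = i then Poly_Mapping.single (\<mu> i) (kos_sign i ({1..m} - {i})) else (0 :: 'k mpol))"
        by (auto simp only: if_True if_False simp_thms)
    qed
    then show ?thesis using that by simp
  qed
  have x_other: "x I j = 0" if "\<not> (\<exists>i\<in>{1..m}. I = {1..m} - {i}) \<or> j \<noteq> 1" for I j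
    unfolding x_def by (rule sum.neutral) (use that in auto)
  have facetE: "\<exists>i\<in>{1..m}. I = {1..m} - {i}" if I: "I \<subseteq> {1..m}" "card I = m - 1" for I
  proof -
    have "card ({1..m} - I) = 1" using I m_ge_2 by (simp add: card_Diff_subset finite_subset)
    then obtain i where "{1..m} - I = {i}" by (auto simp: card_1_singleton_iff)
    then have "i \<in> {1..m}" "I = {1..m} - {i}" using I(1) by blast+
    then show ?thesis by blast
  qed
  have xG: "x \<in> G (m - 1) 0"
  proof (rule GI)
    fix j assume "j \<in> {1..\<beta> 0}"
    then have j: "j = 1" using beta_0 by simp
    show "(\<lambda>I. x I j) \<in> koszul_chains m d a (C j 0) (m - 1)"
    proof (rule koszul_chainsI)
      fix I assume I: "I \<subseteq> {1..m}" "card I = m - 1"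
      then obtain i where i: "i \<in> {1..m}" "I = {1..m} - {i}" using facetE by blast
      show "x I j \<in> poly_ring m"
        using \<mu>(1)[OF i(1)] unfolding i(2) j x_facet[OF i(1)] by (auto simp: poly_ring_def)
      fix \<nu> assume "\<nu> \<in> Poly_Mapping.keys (x I j)"
      then have "\<nu> = \<mu> i" unfolding i(2) j x_facet[OF i(1)] by (auto split: if_splits)
      then show "weight d \<nu> + sum d I + C j 0 = a" using \<mu>(2)[OF i(1)] i(2) j C_0 by simp
    next
      fix I assume no: "\<not> (I \<subseteq> {1..m} \<and> card I = m - 1)"
      have "card ({1..m} - {i}) = m - 1" if "i \<in> {1..m}" for i using that by simp
      with no show "x I j = 0" by (intro x_other) blast
    qed
  next
    fix j I assume "j \<notin> {1..\<beta> 0}"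
    then show "x I j = 0" using beta_0 by (intro x_other) auto
  qed
  have "vmap x \<in> hmap 1 ` G (m - 2) 1"
  proof (rule G_0_in_hmap_image)
    have "Suc (m - 2) = m - 1" using m_ge_2 by arith
    then show "vmap x \<in> G (m - 2) 0" using v_G[of x "m - 2" 0] xG by (simp only:)
    fix I assume I: "I \<subseteq> {1..m}" "card I = m - 2"
    then have "card ({1..m} - I) = 2" using m_ge_2 by (simp add: card_Diff_subset finite_subset)
    then obtain i0 k0 where ik0: "{1..m} - I = {i0, k0}" "i0 \<noteq> k0" by (auto simp: card_2_iff)
    \<comment> \<open>Ordering the two missing vertices decides which of the signs changes.\<close>
    define i where "i = min i0 k0"
    define k where "k = max i0 k0"
    have ik: "{1..m} - I = {i, k}" "i < k" using ik0 by (auto simp: i_def k_def min_def max_def)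
    have mem: "i \<in> {1..m}" "k \<in> {1..m}" "i \<notin> I" "k \<notin> I" using ik by blast+
    have ins: "insert i I = {1..m} - {k}" "insert k I = {1..m} - {i}" using ik I(1) mem by auto
    have fin: "finite I" using I(1) by (rule finite_subset) simp
    have "coeff_sum (vmap x I 1) = kos_sign i I * kos_sign k (insert i I) + kos_sign k I * kos_sign i (insert k I)"
      using ik(2) unfolding coeff_sum_vmap[OF I(1)] ik(1)
      by (simp add: ins x_facet[OF mem(1), unfolded One_nat_def] x_facet[OF mem(2), unfolded One_nat_def])
    also have "\<dots> = (0 :: 'k)" using ik(2) fin mem
      by (simp add: kos_sign_insert_less kos_sign_insert_ge)
    finally show "coeff_sum (vmap x I 1) = 0" .
  qed
  then have "vmap x \<in> hmap 1 ` G (m - 1 - 1) 1" by (simp add: numeral_2_eq_2)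
  from zigzag_from_bottom[OF xG this] obtain u where u: "zigzag u" "u 0 = x" by blast
  have uG: "u (m - 1) \<in> G 0 (m - 1)" using u(1) unfolding zigzag_def by (auto dest!: spec[of _ "m - 1"])
  have fx: "facet_sum x = 1"
    using m_ge_2 unfolding facet_sum_def by (subst x_facet) (auto simp: kos_sign_1[unfolded One_nat_def])
  show ?thesis
  proof (rule ccontr)
    assume no: "\<not> ?thesis"
    \<comment> \<open>A constant term has weight 0 and the empty Koszul index has degree 0, so
      coordinate \<open>j\<close> would have degree exactly \<open>a\<close>.\<close>
    have const0: "Poly_Mapping.lookup (u (m - 1) {} j) 0 = 0" for j
    proof (rule ccontr)
      assume "Poly_Mapping.lookup (u (m - 1) {} j) 0 \<noteq> 0"
      then have key: "0 \<in> Poly_Mapping.keys (u (m - 1) {} j)" by (simp add: in_keys_iff)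
      then have "j \<in> {1..\<beta> (m - 1)}" using GD2[OF uG, of j "{}"] by (metis keys_zero empty_iff)
      moreover have "C j (m - 1) = a" using G_weight[OF uG key] by (simp add: weight_0)
      ultimately show False using no by blast
    qed
    have cycle: "vmap (u (m - 1)) = 0"
    proof (intro ext)
      fix I j
      show "vmap (u (m - 1)) I j = 0 I j"
        using koszul_eq_0_of_chains_0[OF GD1[OF uG, of j], of I] GD2[OF uG, of j]
        by (cases "j \<in> {1..\<beta> (m - 1)}") (auto simp: vmap_def)
    qed
    have "u (m - 1) \<in> vmap ` G 1 (m - 1)" using vmap_lift[OF uG cycle const0] by simp
    from zigzag_bottom_boundary[OF u(1) this]
    obtain w y where w: "w \<in> G (Suc (m - 1)) 0" and y: "y \<in> G (m - 1) 1" and e: "u 0 = vmap w + hmap 1 y"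
      by blast
    \<comment> \<open>A monomial on the full index set would have weight
      \<open>int a - Sigma_gen m d\<close>, which is not in the semigroup.\<close>
    have "Poly_Mapping.keys (w {1..m} 1) = {}"
    proof (rule ccontr)
      assume "Poly_Mapping.keys (w {1..m} 1) \<noteq> {}"
      then obtain \<nu> where \<nu>: "\<nu> \<in> Poly_Mapping.keys (w {1..m} 1)" by blast
      then have "Poly_Mapping.keys \<nu> \<subseteq> {1..m}" using G_poly_ring[OF w] unfolding poly_ring_def by blast
      then have "int (weight d \<nu>) \<in> semigroup_of m d" unfolding semigroup_of_iff_weight by blast
      moreover have "int (weight d \<nu>) = int a - Sigma_gen m d"
        using G_weight[OF w \<nu>] unfolding Sigma_gen_eq C_0 by linarith
      ultimately show False using S(1) by simp
    qed
    then have "facet_sum (vmap w) = 0" by (simp add: facet_sum_vmap)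
    moreover have "x - vmap w = hmap 1 y" using e u(2) by simp
    ultimately have "facet_sum x = 0"
      using facet_sum_diff[of x "vmap w"] facet_sum_hmap[OF y] by simp
    with fx show False by simp
  qed
qed

lemma card_last_degree:
  assumes "\<And>i. i \<in> {1..m} \<Longrightarrow> 0 < d i"
  shows "card {j \<in> {1..\<beta> (m - 1)}. C j (m - 1) = a} =
    (if int a - Sigma_gen m d \<in> pseudo_frobenius (semigroup_of m d) then 1 else 0)"
proof (cases "int a - Sigma_gen m d \<in> pseudo_frobenius (semigroup_of m d)")
  case True
  obtain j where "j \<in> {1..\<beta> (m - 1)}" "C j (m - 1) = a"
    using last_degree_exists[OF assms True] by blast
  then have "{j \<in> {1..\<beta> (m - 1)}. C j (m - 1) = a} = {j}" using last_degree_unique by blast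
  then show ?thesis using True by simp
next
  case False
  then have "{j \<in> {1..\<beta> (m - 1)}. C j (m - 1) = a} = {}"
    using last_degree_pseudo_frobenius[OF assms] by blast
  then show ?thesis using False by (simp only: card.empty if_False)
qed

end

section \<open>Gaps of a numerical semigroup and the functional equation\<close>

section \<open>Reflection of the Hilbert numerator\<close>

lemma semigroup_of_mult_nat: "x \<in> semigroup_of m d \<Longrightarrow> int k * x \<in> semigroup_of m d"
  by (induction k) (auto simp: semigroup_of_0 distrib_right intro: semigroup_of_add)

locale numerical_semigroup =
  fixes m :: nat and d :: "nat \<Rightarrow> nat"
  assumes m_pos: "1 \<le> m" and d_pos: "\<And>i. i \<in> {1..m} \<Longrightarrow> 0 < d i"
    and Gcd_d: "Gcd (d ` {1..m}) = 1"
begin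

abbreviation "S \<equiv> semigroup_of m d"
abbreviation "F \<equiv> frobenius S"
abbreviation "\<Sigma> \<equiv> Sigma_gen m d"

text \<open>The differences of elements of \<open>S\<close> form a group. Its least positive member
  divides every generator by division with remainder, hence equals 1.\<close>

lemma consecutive_elements: "\<exists>s. s \<in> S \<and> s + 1 \<in> S"
proof -
  define D where "D k \<longleftrightarrow> (\<exists>x\<in>S. x + k \<in> S)" for k
  have D_add: "D (k + l)" if kl: "D k" "D l" for k l
  proof -
    from kl obtain x y where "x \<in> S" "x + k \<in> S" "y \<in> S" "y + l \<in> S" unfolding D_def by blast
    then have "x + y \<in> S" "(x + k) + (y + l) \<in> S" by (auto intro: semigroup_of_add)
    then show ?thesis unfolding D_def by (intro bexI[of _ "x + y"]) (auto simp: algebra_simps)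
  qed
  have D_minus: "D (- k)" if "D k" for k
    using that unfolding D_def by (metis add.assoc add.right_inverse add_0_right)
  have D_mult: "D (int n * k)" if "D k" for n k
  proof (induction n)
    case 0
    show ?case unfolding D_def by (intro bexI[of _ 0]) (simp_all add: semigroup_of_0)
  next
    case (Suc n)
    then show ?case using D_add[OF that] by (simp add: distrib_right)
  qed
  have D_gen: "D (int (d i))" if "i \<in> {1..m}" for i
    unfolding D_def using semigroup_of_generator[OF that, of d] semigroup_of_0[of m d] by (intro bexI[of _ 0]) auto
  define g where "g = (LEAST k. 0 < k \<and> D (int k))"
  have ex: "0 < d 1 \<and> D (int (d 1))" using d_pos[of 1] D_gen[of 1] m_pos by simp
  have g: "0 < g" "D (int g)" unfolding g_def using LeastI[of "\<lambda>k. 0 < k \<and> D (int k)", OF ex] by blast+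
  have "g dvd d i" if i: "i \<in> {1..m}" for i
  proof (rule ccontr)
    assume "\<not> g dvd d i"
    then have pos: "0 < d i mod g" by (simp add: dvd_eq_mod_eq_0)
    have "int (d i mod g) = int (d i) + - (int (d i div g) * int g)"
      by (simp add: zmod_int zdiv_int minus_div_mult_eq_mod)
    then have "D (int (d i mod g))" using D_add[OF D_gen[OF i] D_minus[OF D_mult[OF g(2)]]] by simp
    with pos have "g \<le> d i mod g"
      using Least_le[of "\<lambda>k. 0 < k \<and> D (int k)" "d i mod g", folded g_def] by blast
    then show False using mod_less_divisor[OF g(1), of "d i"] by linarith
  qed
  then have "g dvd Gcd (d ` {1..m})" by (intro Gcd_greatest) auto
  then have "g = 1" using Gcd_d by simp
  with g(2) show ?thesis unfolding D_def by auto
qed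

text \<open>With \<open>s\<close> and \<open>s + 1\<close> in \<open>S\<close>, division of
  \<open>x\<close> by \<open>s\<close> with quotient \<open>q\<close> and remainder \<open>r\<close>
  writes \<open>x\<close> as \<open>(q - r) * s + r * (s + 1)\<close>, and
  \<open>q \<ge> s > r\<close> once \<open>x \<ge> s * s\<close>.\<close>

lemma cofinite: "\<exists>N. \<forall>x\<ge>N. x \<in> S"
proof -
  obtain s where s: "s \<in> S" "s + 1 \<in> S" using consecutive_elements by blast
  have s0: "0 \<le> s" using s(1) by (rule semigroup_of_nonneg)
  have "x \<in> S" if x: "x \<ge> s * s" for x
  proof (cases "s = 0")
    case True
    then have "int (nat x) * (s + 1) \<in> S" using s(2) by (intro semigroup_of_mult_nat)
    then show ?thesis using x True by simp
  next
    case False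
    define q r where "q = x div s" and "r = x mod s"
    have r: "0 \<le> r" "r < s" using s0 False by (auto simp: r_def)
    have "s \<le> q" using x s0 False unfolding q_def by (metis div_by_0 le_less nonzero_mult_div_cancel_left zdiv_mono1)
    then have "int (nat (q - r)) * s + int (nat r) * (s + 1) = x"
      using r by (simp add: q_def r_def algebra_simps)
    moreover have "int (nat (q - r)) * s + int (nat r) * (s + 1) \<in> S"
      by (intro semigroup_of_add semigroup_of_mult_nat s)
    ultimately show ?thesis by simp
  qed
  then show ?thesis by blast
qed

lemma frobenius_notin: "F \<notin> S" and le_frobenius: "x \<notin> S \<Longrightarrow> x \<le> F"
proof -
  obtain N where N: "\<And>x. x \<ge> N \<Longrightarrow> x \<in> S" using cofinite by blast
  \<comment> \<open>The number -1 is never in \<open>S\<close>, so the set is nonempty even if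
    \<open>S\<close> contains all nonnegative integers; smaller gaps do not affect the
    maximum.\<close>
  let ?G = "{x. x \<notin> S \<and> - 1 \<le> x}"
  have "x \<le> N" if "x \<notin> S" for x using N[of x] that by linarith
  then have "?G \<subseteq> {- 1..N}" by auto
  then have fin: "finite ?G" by (rule finite_subset) simp
  have mem: "- 1 \<in> ?G" using semigroup_of_nonneg[of "- 1" m d] by auto
  have M: "Max ?G \<in> ?G" using fin mem by (intro Max_in) auto
  have le: "x \<le> Max ?G" if "x \<notin> S" for x
  proof (cases "- 1 \<le> x")
    case True
    then show ?thesis using fin that by (intro Max_ge) auto
  next
    case False
    then show ?thesis using Max_ge[OF fin mem] by linarith
  qed
  have F: "F = Max ?G" unfolding frobenius_def by (rule Greatest_equality) (use M le in auto)
  show "F \<notin> S" using M unfolding F by blast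
  show "x \<notin> S \<Longrightarrow> x \<le> F" unfolding F by (rule le)
qed

lemma Delta_H_range: "Delta_H S \<subseteq> {0..F}"
  unfolding Delta_H_def using le_frobenius by force

lemma finite_Delta_H: "finite (Delta_H S)"
  using Delta_H_range by (rule finite_subset) simp

lemma Delta_H_symmetric: "F - h \<in> Delta_H S \<longleftrightarrow> h \<in> Delta_H S"
  unfolding Delta_H_def by auto

lemma frobenius_pseudo_frobenius: "F \<in> pseudo_frobenius S"
proof -
  have "F + s \<in> S" if "s \<in> S - {0}" for s
    using le_frobenius[of "F + s"] semigroup_of_nonneg[of s m d] that by fastforce
  then show ?thesis unfolding pseudo_frobenius_def using frobenius_notin by blast
qed

lemma frobenius_notin_Delta_H: "F \<notin> Delta_H S"
  unfolding Delta_H_def using semigroup_of_0 by auto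

lemma indicator_partition:
  "of_bool (x \<in> S) + of_bool (F - x \<in> S) + of_bool (x \<in> Delta_H S) = (1 :: rat)"
proof -
  have "\<not> (x \<in> S \<and> F - x \<in> S)"
    using semigroup_of_add[of x m d "F - x"] frobenius_notin by auto
  then show ?thesis unfolding Delta_H_def by auto
qed

text \<open>Multiplication by \<open>\<Prod>\<^sub>j (1 - z ^ d j)\<close> as an operator on two-sided coefficient sequences.
  Unlike formal power series these admit the reflection \<open>x \<mapsto> F - x\<close>.\<close>

definition diff_op :: "(int \<Rightarrow> rat) \<Rightarrow> int \<Rightarrow> rat" where
  "diff_op f x = (\<Sum>I\<in>Pow {1..m}. (- 1) ^ card I * f (x - int (sum d I)))"

lemma diff_op_add: "diff_op (\<lambda>x. f x + g x) x = diff_op f x + diff_op g x"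
  by (simp add: diff_op_def algebra_simps sum.distrib)

lemma diff_op_1: "diff_op (\<lambda>_. 1) x = 0"
proof -
  have "diff_op (\<lambda>_. 1) x = (\<Prod>i\<in>{1..m}. - 1 + (1 :: rat))"
    unfolding diff_op_def by (subst prod_add) auto
  then show ?thesis using m_pos by simp
qed

text \<open>Passing to complements of index sets replaces \<open>sum d I\<close> by
  \<open>\<Sigma> - sum d I\<close> and multiplies the sign by \<open>(- 1) ^ m\<close>.\<close>

lemma diff_op_reflect: "diff_op (\<lambda>x. f (F - x)) x = (- 1) ^ m * diff_op f (F + \<Sigma> - x)"
proof -
  have "diff_op (\<lambda>x. f (F - x)) x =
      (\<Sum>I\<in>Pow {1..m}. (- 1) ^ m * ((- 1) ^ card I * f (F + \<Sigma> - x - int (sum d I))))"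
    unfolding diff_op_def
  proof (rule sum.reindex_bij_witness[of _ "\<lambda>I. {1..m} - I" "\<lambda>I. {1..m} - I"])
    fix I assume "I \<in> Pow {1..m}"
    then have I: "I \<subseteq> {1..m}" by simp
    have fin: "finite I" using I by (rule finite_subset) simp
    have c: "card I \<le> m" using card_mono[OF _ I] by simp
    have "card ({1..m} - I) = m - card I" using I fin by (simp add: card_Diff_subset)
    then have "(- 1 :: rat) ^ m * (- 1) ^ card ({1..m} - I) = (- 1) ^ (m + (m - card I))"
      by (simp add: power_add)
    also have "\<dots> = (- 1) ^ card I"
      using c by (intro minus_one_power_iff[THEN trans] trans[OF _ minus_one_power_iff[symmetric]]) auto
    finally have s: "(- 1 :: rat) ^ m * (- 1) ^ card ({1..m} - I) = (- 1) ^ card I" .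
    have "sum d ({1..m} - I) + sum d I = sum d {1..m}"
      using I by (simp add: sum.subset_diff)
    then have "int (sum d ({1..m} - I)) = \<Sigma> - int (sum d I)" unfolding Sigma_gen_def by linarith
    then have a: "F + \<Sigma> - x - int (sum d ({1..m} - I)) = F - (x - int (sum d I))" by simp
    show "(- 1) ^ m * ((- 1) ^ card ({1..m} - I) * f (F + \<Sigma> - x - int (sum d ({1..m} - I)))) =
      (- 1) ^ card I * f (F - (x - int (sum d I)))"
      unfolding a by (simp only: mult.assoc[symmetric] s)
  qed auto
  then show ?thesis by (simp add: diff_op_def sum_distrib_left)
qed

text \<open>The three indicators of the partition of the integers add up to the constant 1, which
  \<open>diff_op\<close> annihilates.\<close>

lemma diff_op_semigroup_reflect:
  "diff_op (\<lambda>x. of_bool (x \<in> S)) x + (- 1) ^ m * diff_op (\<lambda>x. of_bool (x \<in> S)) (F + \<Sigma> - x) +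
    diff_op (\<lambda>x. of_bool (x \<in> Delta_H S)) x = 0"
proof -
  have "0 = diff_op (\<lambda>x. of_bool (x \<in> S) + of_bool (F - x \<in> S) + of_bool (x \<in> Delta_H S)) x"
    unfolding indicator_partition diff_op_1 ..
  then show ?thesis
    by (simp add: diff_op_add diff_op_reflect[of "\<lambda>x. of_bool (x \<in> S)"])
qed

lemma diff_op_neg:
  assumes "x < 0"
  shows "diff_op (\<lambda>x. of_bool (x \<in> S)) x = 0"
proof -
  have "x - int (sum d I) \<notin> S" for I using semigroup_of_nonneg[of "x - int (sum d I)" m d] assms by linarith
  then show ?thesis unfolding diff_op_def by simp
qed

section \<open>The Hilbert numerator as a product and its value at 1\<close>

abbreviation generator_prod :: "rat fps" where
  "generator_prod \<equiv> (\<Prod>j=1..m. 1 - fps_X ^ d j)"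

lemma hilbert_series_mult_generator_prod_nth:
  "fps_nth (hilbert_series S * generator_prod) k = diff_op (\<lambda>x. of_bool (x \<in> S)) (int k)"
proof -
  have "generator_prod = (\<Prod>j\<in>{1..m}. - (fps_X ^ d j) + 1)" by simp
  also have "\<dots> = (\<Sum>I\<in>Pow {1..m}. (\<Prod>j\<in>I. - (fps_X ^ d j)) * (\<Prod>j\<in>{1..m} - I. 1))"
    by (rule prod_add) simp
  also have "\<dots> = (\<Sum>I\<in>Pow {1..m}. fps_const ((- 1) ^ card I) * fps_X ^ sum d I)"
    by (intro sum.cong refl) (simp add: prod_uminus power_sum flip: fps_const_power fps_const_neg)
  finally have "fps_nth (hilbert_series S * generator_prod) k =
      (\<Sum>I\<in>Pow {1..m}. fps_nth (fps_const ((- 1) ^ card I) * (hilbert_series S * fps_X ^ sum d I)) k)"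
    by (simp add: sum_distrib_left fps_sum_nth mult.left_commute)
  also have "\<dots> = diff_op (\<lambda>x. of_bool (x \<in> S)) (int k)"
    unfolding diff_op_def
  proof (intro sum.cong refl)
    fix I
    have "int k - int (sum d I) \<notin> S" if "k < sum d I"
      using semigroup_of_nonneg[of "int k - int (sum d I)" m d] that by linarith
    then show "fps_nth (fps_const ((- 1) ^ card I) * (hilbert_series S * fps_X ^ sum d I)) k =
      (- 1) ^ card I * of_bool (int k - int (sum d I) \<in> S)"
      by (auto simp: fps_X_power_mult_right_nth hilbert_series_def of_nat_diff simp del: of_nat_sum)
  qed
  finally show ?thesis .
qed

text \<open>The product has constant term 1 because all generators are positive. It is therefore a
  unit, and the division of power series is exact.\<close>

lemma hilbert_numerator_eq:
  assumes "hilbert_series S = N / generator_prod"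
  shows "N = hilbert_series S * generator_prod"
proof -
  have nth0_prod: "fps_nth (prod f A) 0 = (\<Prod>i\<in>A. fps_nth (f i) 0)" for f :: "nat \<Rightarrow> rat fps" and A
    by (induction A rule: infinite_finite_induct) auto
  have "fps_nth generator_prod 0 = (\<Prod>j=1..m. 1)"
    unfolding nth0_prod
  proof (rule prod.cong[OF refl])
    fix j assume "j \<in> {1..m}"
    then show "fps_nth (1 - fps_X ^ d j) 0 = (1 :: rat)" using d_pos[of j] by simp
  qed
  then have "generator_prod dvd 1" unfolding fps_is_unit_iff by simp
  then have "generator_prod dvd N" by (rule unit_imp_dvd)
  then have "N / generator_prod * generator_prod = N" by (rule dvd_div_mult_self)
  then show ?thesis unfolding assms by (rule sym)
qed

text \<open>One factor already turns the Hilbert series into a polynomial, since \<open>S\<close> is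
  cofinite. Another factor remains and vanishes at 1, so the numerator vanishes there.\<close>

lemma hilbert_numerator_sum_0:
  assumes m: "2 \<le> m" and "hilbert_series S = hilbert_numerator m \<beta> C / generator_prod"
  shows "1 + (\<Sum>i=1..m - 1. (- 1) ^ i * rat_of_nat (\<beta> i)) = 0"
proof -
  have one: "1 \<in> {1..m}" using m by simp
  define f where "f = hilbert_series S * (1 - fps_X ^ d 1)"
  \<comment> \<open>From this index on both \<open>k\<close> and \<open>k - d 1\<close> exceed
    \<open>F\<close>, and the two coefficients cancel.\<close>
  define b where "b = Suc (nat F + d 1)"
  have "fps_nth f k = 0" if "b \<le> k" for k
  proof -
    have "int k \<in> S" "int (k - d 1) \<in> S" "d 1 \<le> k"
      using le_frobenius[of "int k"] le_frobenius[of "int (k - d 1)"] that unfolding b_def by linarith+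
    then show ?thesis by (simp add: f_def right_diff_distrib fps_X_power_mult_right_nth hilbert_series_def)
  qed
  then have f: "f = fps_of_poly (truncate_fps b f)" by (auto simp: fps_eq_iff)
  have "hilbert_numerator m \<beta> C = f * (\<Prod>j\<in>{1..m} - {1}. 1 - fps_X ^ d j)"
    using hilbert_numerator_eq[OF assms(2)] prod.remove[OF finite_atLeastAtMost one, of "\<lambda>j. 1 - fps_X ^ d j :: rat fps"]
    by (simp add: f_def mult.assoc)
  also have "\<dots> = fps_of_poly (truncate_fps b f * (\<Prod>j\<in>{1..m} - {1}. 1 - monom 1 (d j)))"
    by (subst f) (simp add: fps_of_poly_mult fps_of_poly_prod fps_of_poly_diff fps_of_poly_monom')
  finally have 1: "hilbert_numerator m \<beta> C = fps_of_poly (truncate_fps b f * (\<Prod>j\<in>{1..m} - {1}. 1 - monom 1 (d j)))" .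
  have 2: "hilbert_numerator m \<beta> C = fps_of_poly (1 + (\<Sum>i=1..m - 1. (- 1) ^ i * (\<Sum>j=1..\<beta> i. monom 1 (C j i))))"
    unfolding hilbert_numerator_def Q_part_def
    by (simp add: fps_of_poly_add fps_of_poly_sum fps_of_poly_mult fps_of_poly_power fps_of_poly_uminus fps_of_poly_monom')
  have "1 + (\<Sum>i=1..m - 1. (- 1) ^ i * (\<Sum>j=1..\<beta> i. monom 1 (C j i))) =
      truncate_fps b f * (\<Prod>j\<in>{1..m} - {1}. 1 - monom 1 (d j))"
    using 1 2 by (simp only: fps_of_poly_eq_iff)
  then have "poly (1 + (\<Sum>i=1..m - 1. (- 1) ^ i * (\<Sum>j=1..\<beta> i. monom 1 (C j i)))) 1 =
      poly (truncate_fps b f * (\<Prod>j\<in>{1..m} - {1}. 1 - monom 1 (d j))) 1" by (rule arg_cong)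
  \<comment> \<open>The witness 2 is a remaining index because \<open>m\<close> is at least
    2.\<close>
  moreover have "poly (\<Prod>j\<in>{1..m} - {1}. 1 - monom 1 (d j)) (1 :: rat) = 0"
    unfolding poly_prod by (rule prod_zero) (use m in \<open>auto simp: poly_monom intro!: exI[of _ 2]\<close>)
  ultimately have "poly (1 + (\<Sum>i=1..m - 1. (- 1) ^ i * (\<Sum>j=1..\<beta> i. monom 1 (C j i)))) (1 :: rat) = 0"
    by (simp only: poly_mult mult_zero_right)
  then show ?thesis by (simp add: poly_sum poly_monom)
qed

end

section \<open>Counting\<close>

lemma count_image_mset_set:
  assumes "finite A"
  shows "count (image_mset f (mset_set A)) x = card {j \<in> A. f j = x}"
proof -
  have "count (image_mset f (mset_set A)) x = (\<Sum>j | j \<in> A \<and> x = f j. 1)"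
    unfolding count_image_mset' using assms by (intro sum.cong) auto
  also have "\<dots> = card {j \<in> A. f j = x}" by (simp add: eq_commute[of x])
  finally show ?thesis .
qed

lemma count_B_mset: "count (B_mset \<beta> C i) x = card {j \<in> {1..\<beta> i}. int (C j i) = x}"
  unfolding B_mset_def by (rule count_image_mset_set) simp

lemma count_Bbar_mset:
  "count (Bbar_mset m d \<beta> C i) x = count (B_mset \<beta> C i) (frobenius (semigroup_of m d) + Sigma_gen m d - x)"
proof -
  have "{j \<in> {1..\<beta> i}. frobenius (semigroup_of m d) + Sigma_gen m d - int (C j i) = x} =
      {j \<in> {1..\<beta> i}. int (C j i) = frobenius (semigroup_of m d) + Sigma_gen m d - x}" by auto
  then show ?thesis unfolding count_B_mset Bbar_mset_def by (simp add: count_image_mset_set)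
qed

lemma sum_odd_even_pairs:
  "(\<Sum>i=1..2 * n. f i) = (\<Sum>i=1..n. f (2 * i - 1)) + (\<Sum>i=1..n. f (2 * i :: nat) :: 'a::comm_monoid_add)"
  by (induction n) (simp_all add: algebra_simps)

lemma hilbert_numerator_nth:
  "fps_nth (hilbert_numerator m \<beta> C) k =
    of_bool (k = 0) + (\<Sum>i=1..m - 1. (- 1) ^ i * rat_of_nat (count (B_mset \<beta> C i) (int k)))"
proof -
  have "fps_nth ((- 1) ^ i * Q_part \<beta> C i) k = (- 1) ^ i * rat_of_nat (count (B_mset \<beta> C i) (int k))" for i
  proof -
    have "fps_nth (Q_part \<beta> C i) k = (\<Sum>j\<in>{1..\<beta> i}. if C j i = k then 1 else 0)"
      unfolding Q_part_def by (simp add: fps_sum_nth eq_commute[of k])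
    also have "\<dots> = rat_of_nat (count (B_mset \<beta> C i) (int k))"
      by (simp add: count_B_mset sum.If_cases Int_def)
    finally show ?thesis by (cases "even i") simp_all
  qed
  then show ?thesis by (simp add: hilbert_numerator_def fps_sum_nth)
qed

section \<open>The terms of the functional equation as multiplicities of degrees\<close>

context numerical_semigroup
begin

text \<open>At negative \<open>x\<close> both sides vanish. This case is included because the
  functional equation evaluates at \<open>F + \<Sigma> - x\<close>, which may be negative.\<close>

lemma diff_op_semigroup_eq_degrees:
  assumes "hilbert_series S = hilbert_numerator m \<beta> C / generator_prod"
  shows "diff_op (\<lambda>x. of_bool (x \<in> S)) x =
    of_bool (x = 0) + (\<Sum>i=1..m - 1. (- 1) ^ i * rat_of_nat (count (B_mset \<beta> C i) x))"
proof (cases "x < 0")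
  case True
  then have "count (B_mset \<beta> C i) x = 0" for i by (auto simp: count_B_mset)
  then show ?thesis using True by (simp add: diff_op_neg)
next
  case False
  then obtain k where "x = int k" by (metis nonneg_int_cases not_less)
  then show ?thesis
    using hilbert_numerator_nth[of m \<beta> C k] hilbert_series_mult_generator_prod_nth[of k]
    unfolding hilbert_numerator_eq[OF assms] by simp
qed

lemma count_L_mset:
  "count (L_mset m d i) x =
    (\<Sum>I\<in>{I. I \<subseteq> {1..m} \<and> card I = i}. of_bool (x - int (sum d I) \<in> Delta_H S))"
proof -
  have "{h \<in> Delta_H S. int (sum d I) + h = x} = (if x - int (sum d I) \<in> Delta_H S then {x - int (sum d I)} else {})" for I
    by auto
  then show ?thesis
    unfolding L_mset_def count_sum
    by (intro sum.cong refl) (simp add: count_image_mset_set finite_Delta_H del: of_nat_sum)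
qed

text \<open>Subsets are grouped by size. The sizes 0 and \<open>m\<close> do not occur in the joins
  \<open>L_odd\<close> and \<open>L_even\<close> and stand apart; oddness of \<open>m\<close> gives
  the minus sign.\<close>

lemma diff_op_Delta_H:
  assumes "odd m"
  shows "diff_op (\<lambda>x. of_bool (x \<in> Delta_H S)) x =
    of_bool (x \<in> Delta_H S) - of_bool (x - \<Sigma> \<in> Delta_H S) +
    (\<Sum>i=1..m - 1. (- 1) ^ i * rat_of_nat (count (L_mset m d i) x))"
proof -
  let ?g = "\<lambda>i. \<Sum>I\<in>{I \<in> Pow {1..m}. card I = i}. (- 1) ^ card I * (of_bool (x - int (sum d I) \<in> Delta_H S) :: rat)"
  have "diff_op (\<lambda>x. of_bool (x \<in> Delta_H S)) x = (\<Sum>i\<in>{0..m}. ?g i)"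
    unfolding diff_op_def
    by (rule sum.group[symmetric]) (auto dest: card_mono[OF finite_atLeastAtMost])
  also have "{0..m} = insert 0 (insert m {1..m - 1})" using m_pos by auto
  also have "(\<Sum>i\<in>insert 0 (insert m {1..m - 1}). ?g i) = ?g 0 + (?g m + (\<Sum>i=1..m - 1. ?g i))"
    using m_pos by (subst sum.insert, simp, simp, subst sum.insert) auto
  also have "?g 0 = of_bool (x \<in> Delta_H S)"
  proof -
    have "{I \<in> Pow {1..m}. card I = 0} = {{}}" by (auto dest: finite_subset)
    then show ?thesis by simp
  qed
  also have "?g m = - of_bool (x - \<Sigma> \<in> Delta_H S)"
  proof -
    have "{I \<in> Pow {1..m}. card I = m} = {{1..m}}" using card_subset_eq[of "{1..m}"] by auto
    then show ?thesis using assms by (simp add: Sigma_gen_def)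
  qed
  also have "(\<Sum>i=1..m - 1. ?g i) = (\<Sum>i=1..m - 1. (- 1) ^ i * rat_of_nat (count (L_mset m d i) x))"
    by (intro sum.cong refl) (simp add: count_L_mset sum_distrib_left Pow_def)
  finally show ?thesis by simp
qed

lemma size_L_mset: "size (L_mset m d i) = (m choose i) * card (Delta_H S)"
  unfolding L_mset_def by (simp add: n_subsets)

end

lemma odd_interval_image: "{i \<in> {1..2 * n}. odd i} = (\<lambda>i. 2 * i - 1) ` {1..n::nat}"
proof (intro equalityI subsetI)
  fix i assume "i \<in> {i \<in> {1..2 * n}. odd i}"
  then show "i \<in> (\<lambda>i. 2 * i - 1) ` {1..n}" by (auto elim!: oddE intro!: image_eqI[of _ _ "Suc (i div 2)"])
qed auto

lemma even_interval_image: "{i \<in> {1..2 * n}. even i} = (\<lambda>i. 2 * i) ` {1..n::nat}"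
  by (auto elim!: evenE)

lemma L_odd_eq: "L_odd (2 * n + 1) d = (\<Sum>i=1..n. L_mset (2 * n + 1) d (2 * i - 1))"
  unfolding L_odd_def diff_add_inverse2 odd_interval_image
  by (subst sum.reindex) (auto simp: inj_on_def)

lemma L_even_eq: "L_even (2 * n + 1) d = (\<Sum>i=1..n. L_mset (2 * n + 1) d (2 * i))"
  unfolding L_even_def diff_add_inverse2 even_interval_image
  by (subst sum.reindex) (auto simp: inj_on_def)

section \<open>Cancellation of the last syzygies and the two linear equations for the Betti
  sums\<close>

theorem theorem6:
  fixes n \<gamma> :: nat
    and d \<beta> :: "nat \<Rightarrow> nat"
    and C :: "nat \<Rightarrow> nat \<Rightarrow> nat"
    and M :: "nat \<Rightarrow> nat \<Rightarrow> nat \<Rightarrow> 'k::field_char_0 mpol"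
  assumes "1 \<le> n"
    and "minimal_generators (2 * n + 1) d"
    and "almost_symmetric (semigroup_of (2 * n + 1) d)"
    and "syzygy_data (2 * n + 1) d \<beta> C M"
    and "\<gamma> = card (Delta_H (semigroup_of (2 * n + 1) d))"
  shows "(\<Sum>i=1..n. rat_of_nat (\<beta> (2 * i - 1))) =
           rat_of_nat \<gamma> * 2 ^ (2 * n - 1) + 1 / 2 * rat_of_int (delta n d \<beta> C) + 1 \<and>
         (\<Sum>i=1..n - 1. rat_of_nat (\<beta> (2 * i))) =
           rat_of_nat \<gamma> * (2 ^ (2 * n - 1) - 1) + 1 / 2 * rat_of_int (delta n d \<beta> C) - 1"
proof -
  define m where "m = 2 * n + 1"
  interpret numerical_semigroup m d
    by unfold_locales (use assms(2) in \<open>auto simp: m_def minimal_generators_def\<close>)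
  have hs: "hilbert_series S = hilbert_numerator m \<beta> C / generator_prod"
    and res: "minimal_graded_resolution m d \<beta> C M"
    using assms(4) unfolding syzygy_data_def m_def by blast+
  have m2: "2 \<le> m" "odd m" "m - 1 = 2 * n" using assms(1) by (auto simp: m_def)
  have pf: "pseudo_frobenius S = insert F (Delta_H S)"
    using assms(3) frobenius_pseudo_frobenius unfolding almost_symmetric_def m_def by blast

  \<comment> \<open>The resolution is examined separately in each degree \<open>a\<close>. In
    negative degrees there are no syzygies, and \<open>x - \<Sigma> + int (d 1)\<close> is still
    negative.\<close>
  have last: "count (B_mset \<beta> C (2 * n)) x = (if x - \<Sigma> \<in> pseudo_frobenius S then 1 else 0)" for x
  proof (cases "0 \<le> x")
    case True
    then obtain a where a: "x = int a" by (rule nonneg_int_cases)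
    interpret graded_resolution m d \<beta> C M a by unfold_locales (use res m2 in auto)
    show ?thesis using card_last_degree d_pos by (simp add: count_B_mset a m2(3)[symmetric])
  next
    case False
    have "x - \<Sigma> + int (d 1) \<notin> S"
    proof
      assume "x - \<Sigma> + int (d 1) \<in> S"
      then have "0 \<le> x - \<Sigma> + int (d 1)" by (rule semigroup_of_nonneg)
      moreover have "int (d 1) \<le> \<Sigma>"
        unfolding Sigma_gen_def using m2 by (intro of_nat_mono member_le_sum) auto
      ultimately show False using False by linarith
    qed
    then have "x - \<Sigma> \<notin> pseudo_frobenius S"
      using pseudo_frobenius_iff[of m d "x - \<Sigma>"] d_pos m2 by auto
    then show ?thesis using False by (auto simp: count_B_mset)
  qed
  \<comment> \<open>The two indicators add up to the multiplicity because \<open>F\<close> is not in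
    \<open>Delta_H S\<close>.\<close>
  then have last': "rat_of_nat (count (B_mset \<beta> C (2 * n)) x) =
      of_bool (x = F + \<Sigma>) + of_bool (x - \<Sigma> \<in> Delta_H S)" for x
    using frobenius_notin_Delta_H by (auto simp: pf)
  have last'': "rat_of_nat (count (B_mset \<beta> C (2 * n)) (F + \<Sigma> - x)) =
      of_bool (x = 0) + of_bool (x \<in> Delta_H S)" for x
    using Delta_H_symmetric[of x] unfolding last' by (auto simp: algebra_simps)

  define Bo where "Bo = (\<Sum>i=1..n. B_mset \<beta> C (2 * i - 1))"
  define Be where "Be = (\<Sum>i=1..n - 1. B_mset \<beta> C (2 * i))"
  define Bbo where "Bbo = (\<Sum>i=1..n. Bbar_mset m d \<beta> C (2 * i - 1))"
  define Bbe where "Bbe = (\<Sum>i=1..n - 1. Bbar_mset m d \<beta> C (2 * i))"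
  have split: "(\<Sum>i=1..2 * n. (- 1) ^ i * f i) =
      (\<Sum>i=1..n - 1. f (2 * i)) + f (2 * n) - (\<Sum>i=1..n. f (2 * i - 1))" for f :: "nat \<Rightarrow> rat"
  proof -
    have "(\<Sum>i=1..n. (- 1) ^ (2 * i - 1) * f (2 * i - 1)) = (\<Sum>i=1..n. - f (2 * i - 1))"
      by (rule sum.cong) auto
    moreover have "(\<Sum>i=1..n. f (2 * i)) = (\<Sum>i=1..n - 1. f (2 * i)) + f (2 * n)"
      using assms(1) by (cases n) auto
    ultimately show ?thesis
      unfolding sum_odd_even_pairs[of "\<lambda>i. (- 1) ^ i * f i"] by (simp add: sum_negf)
  qed
  \<comment> \<open>In the functional equation the leading 1 of the numerator cancels against the
    reflected syzygy degree \<open>F + \<Sigma>\<close>, and conversely. The other last syzygies and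
    their reflections cancel against the subsets of size \<open>m\<close> and 0 in
    \<open>diff_op_Delta_H\<close>.\<close>
  have balance: "Be + Bbo + L_even m d = Bo + Bbe + L_odd m d"
  proof (rule multiset_eqI)
    fix x
    have D: "diff_op (\<lambda>x. of_bool (x \<in> S)) y =
        of_bool (y = 0) + (rat_of_nat (count Be y) + rat_of_nat (count (B_mset \<beta> C (2 * n)) y)
          - rat_of_nat (count Bo y))" for y
      unfolding diff_op_semigroup_eq_degrees[OF hs] m2(3) split
      by (simp add: Be_def Bo_def count_sum)
    have L: "(\<Sum>i=1..2 * n. (- 1) ^ i * rat_of_nat (count (L_mset m d i) x)) =
        rat_of_nat (count (L_even m d) x) - rat_of_nat (count (L_odd m d) x)"
    proof -
      let ?f = "\<lambda>i. rat_of_nat (count (L_mset m d i) x)"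
      \<comment> \<open>Unlike \<open>Be\<close>, the join \<open>L_even\<close> contains the index
        \<open>2 * n\<close>, so the term split off is put back.\<close>
      have "(\<Sum>i=1..n. ?f (2 * i)) = (\<Sum>i=1..n - 1. ?f (2 * i)) + ?f (2 * n)"
        using assms(1) by (cases n) auto
      then show ?thesis unfolding split
        by (simp add: m_def L_odd_eq[simplified] L_even_eq[simplified] count_sum)
    qed
    have b: "count Bbo x = count Bo (F + \<Sigma> - x)" "count Bbe x = count Be (F + \<Sigma> - x)"
      by (simp_all add: Bbo_def Bbe_def Bo_def Be_def count_sum count_Bbar_mset)
    have sg: "(- 1 :: rat) ^ m = - 1" using m2(2) by simp
    have z: "of_bool (F + \<Sigma> - x = 0) = (of_bool (x = F + \<Sigma>) :: rat)" by auto
    have "rat_of_nat (count Be x) + rat_of_nat (count Bbo x) + rat_of_nat (count (L_even m d) x) =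
        rat_of_nat (count Bo x) + rat_of_nat (count Bbe x) + rat_of_nat (count (L_odd m d) x)"
      using diff_op_semigroup_reflect[of x]
      unfolding sg D diff_op_Delta_H[OF m2(2)] m2(3) L last' last'' b z by (simp add: Delta_H_symmetric algebra_simps)
    then have "rat_of_nat (count (Be + Bbo + L_even m d) x) = rat_of_nat (count (Bo + Bbe + L_odd m d) x)"
      by simp
    then show "count (Be + Bbo + L_even m d) x = count (Bo + Bbe + L_odd m d) x"
      by (simp only: of_nat_eq_iff)
  qed

  have sizes: "size Bo = (\<Sum>i=1..n. \<beta> (2 * i - 1))" "size Bbo = (\<Sum>i=1..n. \<beta> (2 * i - 1))"
    "size Be = (\<Sum>i=1..n - 1. \<beta> (2 * i))" "size Bbe = (\<Sum>i=1..n - 1. \<beta> (2 * i))"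
    by (simp_all add: Bo_def Bbo_def Be_def Bbe_def B_mset_def Bbar_mset_def)
  \<comment> \<open>The last Betti number is the number of pseudo-Frobenius numbers, namely
    \<open>F\<close> and the \<open>\<gamma>\<close> elements of \<open>Delta_H S\<close>.\<close>
  have last_size: "\<beta> (2 * n) = \<gamma> + 1"
  proof -
    have "B_mset \<beta> C (2 * n) = image_mset (\<lambda>h. h + \<Sigma>) (mset_set (insert F (Delta_H S)))"
    proof (rule multiset_eqI)
      fix x
      have "{h \<in> insert F (Delta_H S). h + \<Sigma> = x} = (if x - \<Sigma> \<in> insert F (Delta_H S) then {x - \<Sigma>} else {})"
        by auto
      then show "count (B_mset \<beta> C (2 * n)) x = count (image_mset (\<lambda>h. h + \<Sigma>) (mset_set (insert F (Delta_H S)))) x"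
        unfolding last pf by (subst count_image_mset_set) (use finite_Delta_H in auto)
    qed
    then have "size (B_mset \<beta> C (2 * n)) = card (insert F (Delta_H S))" by simp
    then show ?thesis using finite_Delta_H frobenius_notin_Delta_H assms(5)
      by (simp add: B_mset_def m_def)
  qed
  \<comment> \<open>The 2 consists of the leading 1 of the numerator and the last syzygy belonging
    to \<open>F\<close>.\<close>
  have odd_even: "rat_of_nat (size Bo) = rat_of_nat (size Be) + rat_of_nat \<gamma> + 2"
    using hilbert_numerator_sum_0[OF m2(1) hs] unfolding m2(3) split
    by (simp add: sizes last_size)

  \<comment> \<open>The binomial coefficients of \<open>m\<close> with odd lower index add up to
    \<open>2 ^ (2 * n)\<close>; the one with lower index \<open>m\<close> lies outside the range and
    is subtracted.\<close>
  have binom: "2 * rat_of_nat (size (L_odd m d)) = rat_of_nat \<gamma> * (2 * (2 ^ (2 * n) - 1))"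
  proof -
    have "size (L_odd m d) = (\<Sum>i\<in>{i \<in> {1..2 * n}. odd i}. (m choose i) * \<gamma>)"
      unfolding L_odd_def m2(3) by (simp add: size_L_mset assms(5)[folded m_def])
    then have "rat_of_nat (size (L_odd m d)) = rat_of_nat \<gamma> * (\<Sum>i\<in>{i \<in> {1..2 * n}. odd i}. rat_of_nat (m choose i))"
      by (simp add: sum_distrib_left mult.commute)
    also have "(\<Sum>i\<in>{i \<in> {1..2 * n}. odd i}. rat_of_nat (m choose i)) =
        (\<Sum>i\<le>m. if odd i then rat_of_nat (m choose i) else 0) - 1"
    proof -
      have "(\<Sum>i\<le>m. if odd i then rat_of_nat (m choose i) else 0) = (\<Sum>i\<in>{i \<in> {..m}. odd i}. rat_of_nat (m choose i))"
        by (rule sum.inter_filter[symmetric]) simp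
      also have "{i \<in> {..m}. odd i} = insert m {i \<in> {1..2 * n}. odd i}"
        using m2 by (auto simp: m_def le_Suc_eq intro: Suc_leI odd_pos)
      finally show ?thesis by (simp add: m_def)
    qed
    also have "2 * (rat_of_nat \<gamma> * ((\<Sum>i\<le>m. if odd i then rat_of_nat (m choose i) else 0) - 1)) =
        rat_of_nat \<gamma> * (2 * (\<Sum>i\<le>m. if odd i then rat_of_nat (m choose i) else 0) - 2)"
      by (simp add: algebra_simps)
    finally show ?thesis
      using choose_odd_sum[of m, where 'a = rat] m2 by (simp add: m_def)
  qed

  \<comment> \<open>By the balance, the excess of \<open>Be + Bbo\<close> over
    \<open>Bo + Bbe\<close> in each multiplicity equals that of \<open>L_odd\<close> over
    \<open>L_even\<close>; an excess is what remains after removing the intersection.\<close>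
  have "size (Be + Bbo) + size (L_even m d \<inter># L_odd m d) =
      size ((Bo + Bbe) \<inter># (Be + Bbo)) + size (L_odd m d)"
  proof -
    have "count (Be + Bbo) x + count (L_even m d) x = count (Bo + Bbe) x + count (L_odd m d) x" for x
      using arg_cong[OF balance, of "\<lambda>A. count A x"] by simp
    then have "(Be + Bbo) + (L_even m d \<inter># L_odd m d) = ((Bo + Bbe) \<inter># (Be + Bbo)) + L_odd m d"
    proof (intro multiset_eqI)
      fix x
      assume "\<And>x. count (Be + Bbo) x + count (L_even m d) x = count (Bo + Bbe) x + count (L_odd m d) x"
      from this[of x] show "count ((Be + Bbo) + (L_even m d \<inter># L_odd m d)) x =
          count (((Bo + Bbe) \<inter># (Be + Bbo)) + L_odd m d) x"
        by (auto simp: min_def)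
    qed
    from arg_cong[OF this, of size] show ?thesis by simp
  qed
  moreover have delta_eq: "delta n d \<beta> C =
      int (size ((Bo + Bbe) \<inter># (Be + Bbo))) - int (size (L_even m d \<inter># L_odd m d))"
    unfolding delta_def wp_def ell_def Let_def Bo_def Be_def Bbo_def Bbe_def m_def ..
  ultimately have "rat_of_nat (size Be + size Bo) = rat_of_int (delta n d \<beta> C) + rat_of_nat (size (L_odd m d))"
    unfolding delta_eq by (simp add: sizes flip: of_nat_add of_nat_sum)
  then have total: "rat_of_nat (size Be) + rat_of_nat (size Bo) =
      rat_of_int (delta n d \<beta> C) + rat_of_nat \<gamma> * (2 ^ (2 * n) - 1)"
    using binom by (simp add: algebra_simps)
  \<comment> \<open>Sum and difference of the two Betti sums are now known; solving for them halves
    \<open>2 ^ (2 * n)\<close>.\<close>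
  have pow: "(2 :: rat) ^ (2 * n) = 2 * 2 ^ (2 * n - 1)" using assms(1) by (cases n) auto
  show ?thesis
    using total odd_even unfolding pow by (simp add: sizes algebra_simps)
qed

end
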